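(* Let $a\ge b\ge 2$ be integers, and let $r_a,r_b\in\{0,1,2\}$ be the remainders of $a$ and $b$ modulo $3$. If the spider $S(a,b,2)$ is $e$-positive, then either $(r_a,r_b)=(0,1)$ or $r_b=0$. *)

theory Defs
  imports Complex_Main "HOL-Library.FuncSet"
begin

definition is_partition :: "nat \<Rightarrow> nat list \<Rightarrow> bool" where
  "is_partition n lam \<longleftrightarrow> sorted_wrt (\<ge>) lam \<and> 0 \<notin> set lam \<and> sum_list lam = n"

definition partitions :: "nat \<Rightarrow> nat list set" where
  "partitions n = {lam. is_partition n lam}"

text \<open>Graphs on the vertex set {0..<n}, given by a symmetric adjacency relation.
  The chromatic symmetric function X_G is the sum over proper colourings
  kappa : V -> positive integers of the monomial prod_v x_(kappa v).
  Its coefficient of the monomial x_1^(lam_1) ... x_l^(lam_l) (lam a partition of n,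
  colours indexed 0..<l here) is the number of proper colourings with colours in
  {0..<l} using colour i exactly lam_i times.\<close>
definition chrom_coeff :: "nat \<Rightarrow> (nat \<Rightarrow> nat \<Rightarrow> bool) \<Rightarrow> nat list \<Rightarrow> nat" where
  "chrom_coeff n E lam = card {\<kappa> \<in> {0..<n} \<rightarrow>\<^sub>E {0..<length lam}.
      (\<forall>u<n. \<forall>v<n. E u v \<longrightarrow> \<kappa> u \<noteq> \<kappa> v) \<and>
      (\<forall>i<length lam. card {v. v < n \<and> \<kappa> v = i} = lam ! i)}"

text \<open>Coefficient of the monomial x_1^(lam_1) ... x_l^(lam_l) in the elementary symmetric
  function e_mu = prod_j e_(mu_j): number of ways to choose, for each j, a set S_j of
  mu_j variables such that variable i is chosen exactly lam_i times.\<close>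
definition elem_coeff :: "nat list \<Rightarrow> nat list \<Rightarrow> nat" where
  "elem_coeff mu lam = card {S \<in> {0..<length mu} \<rightarrow>\<^sub>E Pow {0..<length lam}.
      (\<forall>j<length mu. card (S j) = mu ! j) \<and>
      (\<forall>i<length lam. card {j. j < length mu \<and> i \<in> S j} = lam ! i)}"

text \<open>X_G is e-positive: it is a nonnegative linear combination of the e_mu, mu a partition
  of n (comparing coefficients of all monomials x^lam, lam a partition of n, which
  determine a homogeneous symmetric function of degree n).\<close>
definition e_positive :: "nat \<Rightarrow> (nat \<Rightarrow> nat \<Rightarrow> bool) \<Rightarrow> bool" where
  "e_positive n E \<longleftrightarrow> (\<exists>c :: nat list \<Rightarrow> real. (\<forall>mu \<in> partitions n. c mu \<ge> 0) \<and>
      (\<forall>lam \<in> partitions n.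
         real (chrom_coeff n E lam) = (\<Sum>mu \<in> partitions n. c mu * real (elem_coeff mu lam))))"

text \<open>The spider S(a,b,c): a centre 0 with three legs (paths) of a, b, c further vertices.
  Leg 1 is 1..a, leg 2 is a+1..a+b, leg 3 is a+b+1..a+b+c; total a+b+c+1 vertices.\<close>
definition spider_edges :: "nat \<Rightarrow> nat \<Rightarrow> nat \<Rightarrow> (nat \<times> nat) set" where
  "spider_edges a b c =
     {(0, 1) | _::unit. a \<ge> 1} \<union> {(0, a + 1) | _::unit. b \<ge> 1} \<union> {(0, a + b + 1) | _::unit. c \<ge> 1} \<union>
     {(i, i + 1) | i. 1 \<le> i \<and> i < a} \<union>
     {(i, i + 1) | i. a + 1 \<le> i \<and> i < a + b} \<union>
     {(i, i + 1) | i. a + b + 1 \<le> i \<and> i < a + b + c}"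

definition spider_adj :: "nat \<Rightarrow> nat \<Rightarrow> nat \<Rightarrow> nat \<Rightarrow> nat \<Rightarrow> bool" where
  "spider_adj a b c u v \<longleftrightarrow> (u, v) \<in> spider_edges a b c \<or> (v, u) \<in> spider_edges a b c"

end

theory Submission
  imports Defs "HOL-Computational_Algebra.Computational_Algebra"
begin

text \<open>
  Let $E(z) = \sum_k e_k z^k$ be a real polynomial with $e_0 = 1$ and $e_k \ge 0$. Factoring
  $E(z) = \prod_i (1 + x_i z)$ over the complex numbers gives finitely many values $x_i$ at which
  the elementary symmetric functions take the values $e_k$; hence an $e$-positive $X_G$ is
  nonnegative at $x$. For the path, $\sum_m P_m z^m = E(z) / (E(z) - z E'(z))$, and for the spider
  \[ X_{S(a,b,2)} = P_{a+b+3} + P_1 P_{a+b+2} + P_2 P_{a+b+1}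
       - P_{b+1} P_{a+2} - P_{b+2} P_{a+1}. \]
  In each excluded residue class a suitable $E$ makes this negative: $1 + z^3$ for $(2,1)$ and
  $(1,2)$, $1 + z + z^3$ for $(2,2)$, and, for small $s > 0$, $1 + s z^2 + z^3$ for $(1,1)$ and
  $1 + z^3 + s z^4$ for $(0,2)$.
\<close>

subsection \<open>Evaluating an $e$-expansion\<close>

text \<open>The choice of E is governed by degrees modulo 3. Under 1 + z^3 every e_mu with a part
  other than 3 vanishes, so X is seen only if its degree a + b + 3 is a multiple of 3, which among
  the excluded classes means (2,1) and (1,2). In the other three all terms vanish, and a further e_j
  has to supply the missing residue. For (2,2) the degree is 1 mod 3, made up by one e_1; the value
  is then exactly linear in e_1, so e_1 = 1 will do. For (1,1) and (0,2) the degree is 2 mod 3, made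
  up by one e_2 or by two e_4. Higher powers of s may occur there too, so only the lowest
  coefficient, that of s or of s^2, is computed, and its sign decides as s tends to 0.

  The points x_i may be complex because nonnegativity is required of the numbers e_k alone, never of
  the x_i.\<close>

text \<open>\<open>e_positive\<close> compares coefficients at partitions only, whereas evaluating
  at a point meets every exponent vector. Dropping the zero entries and sorting the rest links the
  two; \<open>f\<close> records where each part came from.\<close>

lemma exists_partition_of_nonzero_entries:
  fixes lam :: "nat list"
  obtains lam' f where "is_partition (sum_list lam) lam'"
    and "bij_betw f {0..<length lam'} {i. i < length lam \<and> lam ! i \<noteq> 0}"
    and "\<forall>i<length lam'. lam ! (f i) = lam' ! i"
proof -
  define idx where
    "idx = rev (sort_key (\<lambda>i. lam ! i) (filter (\<lambda>i. lam ! i \<noteq> 0) [0..<length lam]))"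
  have set_idx: "set idx = {i. i < length lam \<and> lam ! i \<noteq> 0}"
    by (auto simp: idx_def)
  have dist: "distinct idx"
    by (simp add: idx_def)
  have "sorted (map (\<lambda>i. lam ! i) (rev idx))"
    by (simp add: idx_def)
  then have "sorted_wrt (\<ge>) (map (\<lambda>i. lam ! i) idx)"
    by (metis rev_map rev_rev_ident sorted_wrt_rev)
  moreover have "sum_list (map (\<lambda>i. lam ! i) idx) = sum_list lam"
  proof -
    have "sum_list (map (\<lambda>i. lam ! i) idx) = (\<Sum>i\<in>set idx. lam ! i)"
      by (rule sum_list_distinct_conv_sum_set[OF dist])
    also have "\<dots> = (\<Sum>i = 0..<length lam. lam ! i)"
      unfolding set_idx by (rule sum.mono_neutral_left) auto
    finally show ?thesis
      by (simp add: sum_list_sum_nth)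
  qed
  moreover have "0 \<notin> set (map (\<lambda>i. lam ! i) idx)"
    unfolding set_map set_idx by auto
  ultimately have "is_partition (sum_list lam) (map (\<lambda>i. lam ! i) idx)"
    by (simp add: is_partition_def)
  moreover have "bij_betw (\<lambda>j. idx ! j) {0..<length (map (\<lambda>i. lam ! i) idx)}
      {i. i < length lam \<and> lam ! i \<noteq> 0}"
    using bij_betw_nth[OF dist _ set_idx[symmetric], of "{0..<length idx}"]
    by (simp add: atLeast0LessThan)
  ultimately show ?thesis
    by (rule that) simp
qed

lemma chrom_coeff_reindex:
  assumes f: "bij_betw f {0..<length lam'} {i. i < length lam \<and> lam ! i \<noteq> 0}"
    and lam: "\<forall>i<length lam'. lam ! (f i) = lam' ! i"
  shows "chrom_coeff n E lam = chrom_coeff n E lam'"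
proof -
  define g where "g = inv_into {0..<length lam'} f"
  let ?C = "\<lambda>lam. {\<kappa> \<in> {0..<n} \<rightarrow>\<^sub>E {0..<length lam}.
      (\<forall>u<n. \<forall>v<n. E u v \<longrightarrow> \<kappa> u \<noteq> \<kappa> v) \<and>
      (\<forall>i<length lam. card {v. v < n \<and> \<kappa> v = i} = lam ! i)}"
  have fg: "f (g i) = i" "g i < length lam'" if "i < length lam" "lam ! i \<noteq> 0" for i
    using bij_betw_inv_into_right[OF f, of i] bij_betwE[OF bij_betw_inv_into[OF f], of ] that
    by (auto simp: g_def)
  have gf: "g (f i) = i" if "i < length lam'" for i
    using bij_betw_inv_into_left[OF f, of i] that by (auto simp: g_def)
  have fr: "f i < length lam" "lam ! f i \<noteq> 0" if "i < length lam'" for i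
    using bij_betwE[OF f] that by auto
  have used: "lam ! \<kappa> v \<noteq> 0" "\<kappa> v < length lam" if "\<kappa> \<in> ?C lam" "v < n" for \<kappa> v
  proof -
    show "\<kappa> v < length lam" using that by auto
    then have "card {w. w < n \<and> \<kappa> w = \<kappa> v} = lam ! \<kappa> v" using that by blast
    moreover have "card {w. w < n \<and> \<kappa> w = \<kappa> v} \<noteq> 0" using that by auto
    ultimately show "lam ! \<kappa> v \<noteq> 0" by simp
  qed
  have "bij_betw (\<lambda>\<kappa>. \<lambda>v\<in>{0..<n}. g (\<kappa> v)) (?C lam) (?C lam')"
  proof (rule bij_betw_byWitness[where f' = "\<lambda>\<kappa>. \<lambda>v\<in>{0..<n}. f (\<kappa> v)"])
    show "\<forall>\<kappa>\<in>?C lam. (\<lambda>v\<in>{0..<n}. f ((\<lambda>v\<in>{0..<n}. g (\<kappa> v)) v)) = \<kappa>"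
    proof
      fix \<kappa> assume k: "\<kappa> \<in> ?C lam"
      then have "\<kappa> \<in> extensional {0..<n}" by (auto simp: PiE_def)
      then show "(\<lambda>v\<in>{0..<n}. f ((\<lambda>v\<in>{0..<n}. g (\<kappa> v)) v)) = \<kappa>"
        using used[OF k] fg by (auto simp: fun_eq_iff restrict_def extensional_def)
    qed
    show "\<forall>\<kappa>\<in>?C lam'. (\<lambda>v\<in>{0..<n}. g ((\<lambda>v\<in>{0..<n}. f (\<kappa> v)) v)) = \<kappa>"
    proof
      fix \<kappa> assume k: "\<kappa> \<in> ?C lam'"
      then have "\<kappa> \<in> extensional {0..<n}" "\<And>v. v < n \<Longrightarrow> \<kappa> v < length lam'"
        by (auto simp: PiE_def)
      then show "(\<lambda>v\<in>{0..<n}. g ((\<lambda>v\<in>{0..<n}. f (\<kappa> v)) v)) = \<kappa>"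
        using gf by (auto simp: fun_eq_iff restrict_def extensional_def)
    qed
    show "(\<lambda>\<kappa>. \<lambda>v\<in>{0..<n}. g (\<kappa> v)) ` ?C lam \<subseteq> ?C lam'"
    proof
      fix \<kappa>' assume "\<kappa>' \<in> (\<lambda>\<kappa>. \<lambda>v\<in>{0..<n}. g (\<kappa> v)) ` ?C lam"
      then obtain \<kappa> where k: "\<kappa> \<in> ?C lam" and k': "\<kappa>' = (\<lambda>v\<in>{0..<n}. g (\<kappa> v))" by blast
      have eq: "g (\<kappa> v) = i \<longleftrightarrow> \<kappa> v = f i" if "v < n" "i < length lam'" for v i
        using used[OF k that(1)] fg gf that by metis
      have ne: "g (\<kappa> u) \<noteq> g (\<kappa> v)" if "u < n" "v < n" "\<kappa> u \<noteq> \<kappa> v" for u v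
        using used[OF k] fg that by metis
      have "card {v. v < n \<and> \<kappa>' v = i} = lam' ! i" if "i < length lam'" for i
      proof -
        have "{v. v < n \<and> \<kappa>' v = i} = {v. v < n \<and> \<kappa> v = f i}"
          using eq that by (auto simp: k')
        then show ?thesis using k fr lam that by simp
      qed
      moreover have "\<forall>u<n. \<forall>v<n. E u v \<longrightarrow> \<kappa>' u \<noteq> \<kappa>' v"
        using k ne by (simp add: k')
      moreover have "\<kappa>' \<in> {0..<n} \<rightarrow>\<^sub>E {0..<length lam'}"
        using used[OF k] fg by (auto simp: k')
      ultimately show "\<kappa>' \<in> ?C lam'" by blast
    qed
    show "(\<lambda>\<kappa>. \<lambda>v\<in>{0..<n}. f (\<kappa> v)) ` ?C lam' \<subseteq> ?C lam"
    proof
      fix \<kappa>' assume "\<kappa>' \<in> (\<lambda>\<kappa>. \<lambda>v\<in>{0..<n}. f (\<kappa> v)) ` ?C lam'"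
      then obtain \<kappa> where k: "\<kappa> \<in> ?C lam'" and k': "\<kappa>' = (\<lambda>v\<in>{0..<n}. f (\<kappa> v))" by blast
      have r: "\<kappa> v < length lam'" if "v < n" for v using k that by auto
      have "card {v. v < n \<and> \<kappa>' v = i} = lam ! i" if "i < length lam" for i
      proof (cases "lam ! i = 0")
        case True
        then have "\<kappa>' v \<noteq> i" if "v < n" for v
          using r[OF that] fr[of "\<kappa> v"] that by (auto simp: k')
        then have "{v. v < n \<and> \<kappa>' v = i} = {}" by blast
        then show ?thesis using True by (metis card.empty)
      next
        case False
        have "{v. v < n \<and> \<kappa>' v = i} = {v. v < n \<and> \<kappa> v = g i}"
          using r fg[OF that False] gf by (auto simp: k')
        then show ?thesis using k fg[OF that False] lam[rule_format, of "g i"] by simp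
      qed
      moreover have "\<forall>u<n. \<forall>v<n. E u v \<longrightarrow> \<kappa>' u \<noteq> \<kappa>' v"
        using k r gf by (simp add: k') metis
      moreover have "\<kappa>' \<in> {0..<n} \<rightarrow>\<^sub>E {0..<length lam}"
        using r fr by (auto simp: k')
      ultimately show "\<kappa>' \<in> ?C lam" by blast
    qed
  qed
  then show ?thesis
    unfolding chrom_coeff_def by (rule bij_betw_same_card)
qed

text \<open>An index with exponent 0 lies in none of the sets \<open>S j\<close>, so taking images
  under \<open>f\<close> and its inverse matches the two families of choices.\<close>

lemma elem_coeff_reindex:
  assumes f: "bij_betw f {0..<length lam'} {i. i < length lam \<and> lam ! i \<noteq> 0}"
    and lam: "\<forall>i<length lam'. lam ! (f i) = lam' ! i"
  shows "elem_coeff mu lam = elem_coeff mu lam'"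
proof -
  define g where "g = inv_into {0..<length lam'} f"
  let ?J = "{0..<length mu}"
  let ?C = "\<lambda>lam. {S \<in> {0..<length mu} \<rightarrow>\<^sub>E Pow {0..<length lam}.
      (\<forall>j<length mu. card (S j) = mu ! j) \<and>
      (\<forall>i<length lam. card {j. j < length mu \<and> i \<in> S j} = lam ! i)}"
  let ?N = "{i. i < length lam \<and> lam ! i \<noteq> 0}"
  have fg: "f (g i) = i" "g i < length lam'" if "i < length lam" "lam ! i \<noteq> 0" for i
    using bij_betw_inv_into_right[OF f, of i] bij_betwE[OF bij_betw_inv_into[OF f], of ] that
    by (auto simp: g_def)
  have gf: "g (f i) = i" if "i < length lam'" for i
    using bij_betw_inv_into_left[OF f, of i] that by (auto simp: g_def)
  have fr: "f i < length lam" "lam ! f i \<noteq> 0" if "i < length lam'" for i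
    using bij_betwE[OF f] that by auto
  have used: "S j \<subseteq> ?N" if "S \<in> ?C lam" "j < length mu" for S j
  proof
    fix i assume i: "i \<in> S j"
    have "S j \<subseteq> {0..<length lam}" using that by auto
    then have "i < length lam" using i by auto
    then have "card {j. j < length mu \<and> i \<in> S j} = lam ! i" using that by blast
    moreover have "card {j. j < length mu \<and> i \<in> S j} \<noteq> 0" using that i by auto
    ultimately show "i \<in> ?N" using \<open>i < length lam\<close> by auto
  qed
  have inj_g: "inj_on g ?N"
    using bij_betw_inv_into[OF f] by (simp add: g_def bij_betw_def)
  have inj_f: "inj_on f {0..<length lam'}"
    using f by (simp add: bij_betw_def)
  have "bij_betw (\<lambda>S. \<lambda>j\<in>?J. g ` S j) (?C lam) (?C lam')"
  proof (rule bij_betw_byWitness[where f' = "\<lambda>S. \<lambda>j\<in>?J. f ` S j"])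
    show "\<forall>S\<in>?C lam. (\<lambda>j\<in>?J. f ` ((\<lambda>j\<in>?J. g ` S j) j)) = S"
    proof
      fix S assume S: "S \<in> ?C lam"
      then have ext: "S \<in> extensional ?J" by (auto simp: PiE_def)
      have "f ` g ` S j = S j" if "j < length mu" for j
        using used[OF S that] fg by (force simp: image_image)
      then show "(\<lambda>j\<in>?J. f ` ((\<lambda>j\<in>?J. g ` S j) j)) = S"
        using ext by (auto simp: fun_eq_iff restrict_def extensional_def)
    qed
    show "\<forall>S\<in>?C lam'. (\<lambda>j\<in>?J. g ` ((\<lambda>j\<in>?J. f ` S j) j)) = S"
    proof
      fix S assume S: "S \<in> ?C lam'"
      then have ext: "S \<in> extensional ?J" by (auto simp: PiE_def)
      have "g ` f ` S j = S j" if "j < length mu" for j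
      proof -
        have "S j \<subseteq> {0..<length lam'}" using S that by auto
        then show ?thesis using gf by (force simp: image_image)
      qed
      then show "(\<lambda>j\<in>?J. g ` ((\<lambda>j\<in>?J. f ` S j) j)) = S"
        using ext by (auto simp: fun_eq_iff restrict_def extensional_def)
    qed
    show "(\<lambda>S. \<lambda>j\<in>?J. g ` S j) ` ?C lam \<subseteq> ?C lam'"
    proof
      fix S' assume "S' \<in> (\<lambda>S. \<lambda>j\<in>?J. g ` S j) ` ?C lam"
      then obtain S where S: "S \<in> ?C lam" and S': "S' = (\<lambda>j\<in>?J. g ` S j)" by blast
      have eq: "i \<in> g ` S j \<longleftrightarrow> f i \<in> S j" if "j < length mu" "i < length lam'" for j i
        using used[OF S that(1)] fg gf[OF that(2)] by force
      have "card {j. j < length mu \<and> i \<in> S' j} = lam' ! i" if "i < length lam'" for i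
      proof -
        have "{j. j < length mu \<and> i \<in> S' j} = {j. j < length mu \<and> f i \<in> S j}"
          using eq that by (auto simp: S')
        then show ?thesis using S fr lam that by simp
      qed
      moreover have "\<forall>j<length mu. card (S' j) = mu ! j"
        using S used[OF S] card_image[OF inj_on_subset[OF inj_g]] by (simp add: S')
      moreover have "S' \<in> ?J \<rightarrow>\<^sub>E Pow {0..<length lam'}"
      proof (rule PiE_I)
        fix j assume "j \<in> ?J"
        then show "S' j \<in> Pow {0..<length lam'}"
          using used[OF S, of j] fg(2) unfolding S' by fastforce
      qed (simp add: S')
      ultimately show "S' \<in> ?C lam'" by blast
    qed
    show "(\<lambda>S. \<lambda>j\<in>?J. f ` S j) ` ?C lam' \<subseteq> ?C lam"
    proof
      fix S' assume "S' \<in> (\<lambda>S. \<lambda>j\<in>?J. f ` S j) ` ?C lam'"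
      then obtain S where S: "S \<in> ?C lam'" and S': "S' = (\<lambda>j\<in>?J. f ` S j)" by blast
      have r: "S j \<subseteq> {0..<length lam'}" if "j < length mu" for j using S that by auto
      have "card {j. j < length mu \<and> i \<in> S' j} = lam ! i" if "i < length lam" for i
      proof (cases "lam ! i = 0")
        case True
        then have "i \<notin> S' j" if "j < length mu" for j
          using r[OF that] fr that by (force simp: S')
        then have "{j. j < length mu \<and> i \<in> S' j} = {}" by blast
        then show ?thesis using True by (metis card.empty)
      next
        case False
        have "i \<in> f ` S j \<longleftrightarrow> g i \<in> S j" if "j < length mu" for j
          using r[OF that] fg[OF \<open>i < length lam\<close> False] gf by force
        then have "{j. j < length mu \<and> i \<in> S' j} = {j. j < length mu \<and> g i \<in> S j}"
          by (auto simp: S')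
        then show ?thesis using S fg[OF that False] lam[rule_format, of "g i"] by simp
      qed
      moreover have "\<forall>j<length mu. card (S' j) = mu ! j"
        using S r card_image[OF inj_on_subset[OF inj_f]] by (simp add: S')
      moreover have "S' \<in> ?J \<rightarrow>\<^sub>E Pow {0..<length lam}"
      proof (rule PiE_I)
        fix j assume "j \<in> ?J"
        then show "S' j \<in> Pow {0..<length lam}"
          using r[of j] fr unfolding S' by fastforce
      qed (simp add: S')
      ultimately show "S' \<in> ?C lam" by blast
    qed
  qed
  then show ?thesis
    unfolding elem_coeff_def by (rule bij_betw_same_card)
qed

section \<open>Symmetric functions evaluated at finitely many ring elements\<close>

definition chrom_eval :: "nat \<Rightarrow> (nat \<Rightarrow> nat \<Rightarrow> bool) \<Rightarrow> nat \<Rightarrow> (nat \<Rightarrow> 'a) \<Rightarrow> 'a::comm_ring_1" where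
  "chrom_eval n E l x = (\<Sum>\<kappa> \<in> {\<kappa> \<in> {0..<n} \<rightarrow>\<^sub>E {0..<l}. \<forall>u<n. \<forall>v<n. E u v \<longrightarrow> \<kappa> u \<noteq> \<kappa> v}.
     \<Prod>v = 0..<n. x (\<kappa> v))"

definition elem_eval :: "nat \<Rightarrow> (nat \<Rightarrow> 'a) \<Rightarrow> nat \<Rightarrow> 'a::comm_ring_1" where
  "elem_eval l x k = (\<Sum>S \<in> {S \<in> Pow {0..<l}. card S = k}. \<Prod>i\<in>S. x i)"

lemma restrict_eq_iff:
  assumes "\<alpha> \<in> extensional A"
  shows "restrict f A = \<alpha> \<longleftrightarrow> (\<forall>i\<in>A. f i = \<alpha> i)"
  using assms by (auto intro!: extensionalityI[of _ A])

text \<open>Colourings are grouped by the vector of class sizes. The box \<open>{0..n}\<close> for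
  the exponents is larger than the set of vectors of degree \<open>n\<close>, but it is finite and
  also serves for products of elementary functions.\<close>

lemma chrom_eval_expand:
  "chrom_eval n E l x = (\<Sum>\<alpha> \<in> {0..<l} \<rightarrow>\<^sub>E {0..n}.
     of_nat (chrom_coeff n E (map \<alpha> [0..<l])) * (\<Prod>i = 0..<l. x i ^ \<alpha> i))"
proof -
  let ?K = "{\<kappa> \<in> {0..<n} \<rightarrow>\<^sub>E {0..<l}. \<forall>u<n. \<forall>v<n. E u v \<longrightarrow> \<kappa> u \<noteq> \<kappa> v}"
  let ?g = "\<lambda>\<kappa>. \<lambda>i\<in>{0..<l}. card {v. v < n \<and> \<kappa> v = i}"
  let ?T = "{0..<l} \<rightarrow>\<^sub>E {0..n}"
  have fin: "finite ?K"
    by (rule finite_subset[of _ "{0..<n} \<rightarrow>\<^sub>E {0..<l}"]) (auto intro: finite_PiE)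
  have card_le: "card {v. v < n \<and> \<kappa> v = i} \<le> n" for \<kappa> :: "nat \<Rightarrow> nat" and i
    using card_mono[of "{0..<n}" "{v. v < n \<and> \<kappa> v = i}"] by (simp add: subset_iff)
  have inner: "(\<Sum>\<kappa> \<in> {\<kappa>. \<kappa> \<in> ?K \<and> ?g \<kappa> = \<alpha>}. \<Prod>v = 0..<n. x (\<kappa> v)) =
      of_nat (chrom_coeff n E (map \<alpha> [0..<l])) * (\<Prod>i = 0..<l. x i ^ \<alpha> i)"
    if \<alpha>: "\<alpha> \<in> ?T" for \<alpha>
  proof -
    have ext: "?g \<kappa> = \<alpha> \<longleftrightarrow> (\<forall>i<l. card {v. v < n \<and> \<kappa> v = i} = \<alpha> i)" for \<kappa>
      using \<alpha> by (subst restrict_eq_iff) (auto simp: PiE_def)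
    have "{\<kappa>. \<kappa> \<in> ?K \<and> ?g \<kappa> = \<alpha>} = {\<kappa> \<in> {0..<n} \<rightarrow>\<^sub>E {0..<length (map \<alpha> [0..<l])}.
      (\<forall>u<n. \<forall>v<n. E u v \<longrightarrow> \<kappa> u \<noteq> \<kappa> v) \<and>
      (\<forall>i<length (map \<alpha> [0..<l]). card {v. v < n \<and> \<kappa> v = i} = map \<alpha> [0..<l] ! i)}"
      unfolding ext by auto
    then have "card {\<kappa>. \<kappa> \<in> ?K \<and> ?g \<kappa> = \<alpha>} = chrom_coeff n E (map \<alpha> [0..<l])"
      by (simp add: chrom_coeff_def)
    moreover have "(\<Sum>\<kappa> \<in> {\<kappa>. \<kappa> \<in> ?K \<and> ?g \<kappa> = \<alpha>}. \<Prod>v = 0..<n. x (\<kappa> v)) =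
        (\<Sum>\<kappa> \<in> {\<kappa>. \<kappa> \<in> ?K \<and> ?g \<kappa> = \<alpha>}. \<Prod>i = 0..<l. x i ^ \<alpha> i)"
    proof (rule sum.cong[OF refl])
      fix \<kappa> assume that: "\<kappa> \<in> {\<kappa>. \<kappa> \<in> ?K \<and> ?g \<kappa> = \<alpha>}"
      have "(\<Prod>v = 0..<n. x (\<kappa> v)) =
          (\<Prod>i = 0..<l. \<Prod>v\<in>{v. v \<in> {0..<n} \<and> \<kappa> v = i}. x (\<kappa> v))"
        by (rule prod.group[symmetric]) (use that in auto)
      also have "\<dots> = (\<Prod>i = 0..<l. x i ^ \<alpha> i)"
      proof (rule prod.cong[OF refl])
        fix i assume "i \<in> {0..<l}"
        then have "card {v. v \<in> {0..<n} \<and> \<kappa> v = i} = \<alpha> i"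
          using that ext by auto
        then show "(\<Prod>v\<in>{v. v \<in> {0..<n} \<and> \<kappa> v = i}. x (\<kappa> v)) = x i ^ \<alpha> i"
          by simp
      qed
      finally show "(\<Prod>v = 0..<n. x (\<kappa> v)) = (\<Prod>i = 0..<l. x i ^ \<alpha> i)" .
    qed
    ultimately show ?thesis
      by simp
  qed
  have "chrom_eval n E l x =
      (\<Sum>\<alpha>\<in>?T. \<Sum>\<kappa> \<in> {\<kappa>. \<kappa> \<in> ?K \<and> ?g \<kappa> = \<alpha>}. \<Prod>v = 0..<n. x (\<kappa> v))"
    unfolding chrom_eval_def
    by (rule sum.group[symmetric]) (use fin card_le in \<open>auto intro: finite_PiE\<close>)
  then show ?thesis
    using inner by simp
qed

text \<open>Multiplying out means choosing one set \<open>S j\<close> per factor, and the exponent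
  of \<open>x i\<close> is the number of chosen sets containing \<open>i\<close>. It is at most
  \<open>length mu\<close>, so the bound on the length keeps it in the box.\<close>

lemma prod_elem_eval_expand:
  assumes len: "length mu \<le> n"
  shows "(\<Prod>j = 0..<length mu. elem_eval l x (mu ! j)) = (\<Sum>\<alpha> \<in> {0..<l} \<rightarrow>\<^sub>E {0..n}.
     of_nat (elem_coeff mu (map \<alpha> [0..<l])) * (\<Prod>i = 0..<l. x i ^ \<alpha> i))"
proof -
  let ?J = "{0..<length mu}"
  let ?K = "PiE ?J (\<lambda>j. {S \<in> Pow {0..<l}. card S = mu ! j})"
  let ?g = "\<lambda>S. \<lambda>i\<in>{0..<l}. card {j. j < length mu \<and> i \<in> S j}"
  let ?T = "{0..<l} \<rightarrow>\<^sub>E {0..n}"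
  have fin: "finite ?K"
    by (rule finite_PiE) auto
  have card_le: "card {j. j < length mu \<and> i \<in> S j} \<le> n" for S :: "nat \<Rightarrow> nat set" and i
    using card_mono[of ?J "{j. j < length mu \<and> i \<in> S j}"] len by (simp add: subset_iff)
  have inner: "(\<Sum>S \<in> {S. S \<in> ?K \<and> ?g S = \<alpha>}. \<Prod>j\<in>?J. \<Prod>i\<in>S j. x i) =
      of_nat (elem_coeff mu (map \<alpha> [0..<l])) * (\<Prod>i = 0..<l. x i ^ \<alpha> i)"
    if \<alpha>: "\<alpha> \<in> ?T" for \<alpha>
  proof -
    have ext: "?g S = \<alpha> \<longleftrightarrow> (\<forall>i<l. card {j. j < length mu \<and> i \<in> S j} = \<alpha> i)" for S
      using \<alpha> by (subst restrict_eq_iff) (auto simp: PiE_def)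
    have "{S. S \<in> ?K \<and> ?g S = \<alpha>} = {S \<in> {0..<length mu} \<rightarrow>\<^sub>E Pow {0..<length (map \<alpha> [0..<l])}.
      (\<forall>j<length mu. card (S j) = mu ! j) \<and>
      (\<forall>i<length (map \<alpha> [0..<l]).
         card {j. j < length mu \<and> i \<in> S j} = map \<alpha> [0..<l] ! i)}"
      unfolding ext by (auto simp: PiE_iff)
    then have "card {S. S \<in> ?K \<and> ?g S = \<alpha>} = elem_coeff mu (map \<alpha> [0..<l])"
      by (simp add: elem_coeff_def)
    moreover have "(\<Sum>S \<in> {S. S \<in> ?K \<and> ?g S = \<alpha>}. \<Prod>j\<in>?J. \<Prod>i\<in>S j. x i) =
        (\<Sum>S \<in> {S. S \<in> ?K \<and> ?g S = \<alpha>}. \<Prod>i = 0..<l. x i ^ \<alpha> i)"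
    proof (rule sum.cong[OF refl])
      fix S assume S: "S \<in> {S. S \<in> ?K \<and> ?g S = \<alpha>}"
      have "(\<Prod>j\<in>?J. \<Prod>i\<in>S j. x i) = (\<Prod>j\<in>?J. \<Prod>i\<in>{i. i \<in> {0..<l} \<and> i \<in> S j}. x i)"
      proof (rule prod.cong[OF refl])
        fix j assume "j \<in> ?J"
        then have "S j \<subseteq> {0..<l}" using S by (auto simp: PiE_iff)
        then have "{i. i \<in> {0..<l} \<and> i \<in> S j} = S j" by blast
        then show "(\<Prod>i\<in>S j. x i) = (\<Prod>i\<in>{i. i \<in> {0..<l} \<and> i \<in> S j}. x i)" by simp
      qed
      also have "\<dots> = (\<Prod>i = 0..<l. \<Prod>j\<in>{j. j \<in> ?J \<and> i \<in> S j}. x i)"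
        by (rule prod.swap_restrict) auto
      also have "\<dots> = (\<Prod>i = 0..<l. x i ^ \<alpha> i)"
        using S ext by (intro prod.cong[OF refl]) auto
      finally show "(\<Prod>j\<in>?J. \<Prod>i\<in>S j. x i) = (\<Prod>i = 0..<l. x i ^ \<alpha> i)" .
    qed
    ultimately show ?thesis
      by simp
  qed
  have "(\<Prod>j\<in>?J. elem_eval l x (mu ! j)) = (\<Sum>S\<in>?K. \<Prod>j\<in>?J. \<Prod>i\<in>S j. x i)"
    unfolding elem_eval_def by (rule prod_sum_PiE) auto
  also have "\<dots> = (\<Sum>\<alpha>\<in>?T. \<Sum>S \<in> {S. S \<in> ?K \<and> ?g S = \<alpha>}. \<Prod>j\<in>?J. \<Prod>i\<in>S j. x i)"
    by (rule sum.group[symmetric]) (use fin card_le in \<open>auto intro: finite_PiE\<close>)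
  finally show ?thesis
    using inner by simp
qed

text \<open>Summing the class sizes over all colours counts each vertex once. This disposes of the
  exponent vectors in the box that have the wrong degree.\<close>

lemma chrom_coeff_eq_0:
  assumes "sum_list lam \<noteq> n"
  shows "chrom_coeff n E lam = 0"
proof -
  have "sum_list lam = n"
    if k: "\<kappa> \<in> {0..<n} \<rightarrow>\<^sub>E {0..<length lam}"
      and c: "\<forall>i<length lam. card {v. v < n \<and> \<kappa> v = i} = lam ! i" for \<kappa>
  proof -
    have "{i \<in> {0..<length lam}. \<kappa> v = i} = {\<kappa> v}" if "v < n" for v
      using k that by auto
    then have "(\<Sum>i = 0..<length lam. card {v\<in>{0..<n}. \<kappa> v = i}) = (\<Sum>v = 0..<n. 1)"
      by (intro sum_multicount_gen) auto
    then show ?thesis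
      using c by (simp add: sum_list_sum_nth)
  qed
  then show ?thesis
    using assms unfolding chrom_coeff_def by (auto intro!: card_eq_0_iff[THEN iffD2])
qed

text \<open>Double counting of the pairs (i, j) with \<open>i\<close> in \<open>S j\<close>.\<close>

lemma elem_coeff_eq_0:
  assumes "sum_list lam \<noteq> sum_list mu"
  shows "elem_coeff mu lam = 0"
proof -
  have "sum_list lam = sum_list mu"
    if S: "S \<in> {0..<length mu} \<rightarrow>\<^sub>E Pow {0..<length lam}"
      and c: "\<forall>j<length mu. card (S j) = mu ! j"
      and d: "\<forall>i<length lam. card {j. j < length mu \<and> i \<in> S j} = lam ! i" for S
  proof -
    have "{i \<in> {0..<length lam}. i \<in> S j} = S j" if "j < length mu" for j
      using PiE_mem[OF S, of j] that by auto
    then have "(\<Sum>i = 0..<length lam. card {j\<in>{0..<length mu}. i \<in> S j}) =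
        (\<Sum>j = 0..<length mu. mu ! j)"
      using c by (intro sum_multicount_gen) auto
    then show ?thesis
      using d by (simp add: sum_list_sum_nth)
  qed
  then show ?thesis
    using assms unfolding elem_coeff_def by (auto intro!: card_eq_0_iff[THEN iffD2])
qed

lemma length_le_sum_list:
  assumes "0 \<notin> set (xs :: nat list)"
  shows "length xs \<le> sum_list xs"
  using assms by (induction xs) auto

text \<open>The coefficient identity extends from partitions to all exponent vectors: in the wrong
  degree both sides vanish, and in degree \<open>n\<close> both are unchanged by passing to the
  sorted nonzero entries. It is then summed against the monomials.\<close>

lemma e_expansion_eval:
  fixes x :: "nat \<Rightarrow> 'a::{real_algebra_1, comm_ring_1}"
  assumes c: "\<And>lam. lam \<in> partitions n \<Longrightarrow>
      real (chrom_coeff n E lam) = (\<Sum>mu \<in> partitions n. c mu * real (elem_coeff mu lam))"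
  shows "chrom_eval n E l x =
      (\<Sum>mu \<in> partitions n. of_real (c mu) * (\<Prod>j = 0..<length mu. elem_eval l x (mu ! j)))"
proof -
  let ?T = "{0..<l} \<rightarrow>\<^sub>E {0..n}"
  have mu: "sum_list mu = n" "length mu \<le> n" if "mu \<in> partitions n" for mu
    using that length_le_sum_list[of mu] by (auto simp: partitions_def is_partition_def)
  have coeff: "real (chrom_coeff n E lam) =
      (\<Sum>mu \<in> partitions n. c mu * real (elem_coeff mu lam))" for lam
  proof (cases "sum_list lam = n")
    case True
    obtain lam' f where lam': "is_partition (sum_list lam) lam'"
      and f: "bij_betw f {0..<length lam'} {i. i < length lam \<and> lam ! i \<noteq> 0}"
        "\<forall>i<length lam'. lam ! (f i) = lam' ! i"
      by (rule exists_partition_of_nonzero_entries[of lam])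
    show ?thesis
      using c[of lam'] lam' True
      by (simp add: partitions_def chrom_coeff_reindex[OF f] elem_coeff_reindex[OF f])
  next
    case False
    then show ?thesis
      using mu by (simp add: chrom_coeff_eq_0 elem_coeff_eq_0)
  qed
  have coeff': "of_nat (chrom_coeff n E lam) =
      (\<Sum>mu \<in> partitions n. of_real (c mu) * (of_nat (elem_coeff mu lam) :: 'a))" for lam
    using arg_cong[OF coeff[of lam], of "of_real :: real \<Rightarrow> 'a"] by simp
  have "chrom_eval n E l x = (\<Sum>\<alpha>\<in>?T. \<Sum>mu\<in>partitions n.
      of_real (c mu) * (of_nat (elem_coeff mu (map \<alpha> [0..<l])) * (\<Prod>i = 0..<l. x i ^ \<alpha> i)))"
    by (simp add: chrom_eval_expand coeff' sum_distrib_right mult.assoc)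
  also have "\<dots> = (\<Sum>mu\<in>partitions n. \<Sum>\<alpha>\<in>?T.
      of_real (c mu) * (of_nat (elem_coeff mu (map \<alpha> [0..<l])) * (\<Prod>i = 0..<l. x i ^ \<alpha> i)))"
    by (rule sum.swap)
  also have "\<dots> = (\<Sum>mu \<in> partitions n.
      of_real (c mu) * (\<Prod>j = 0..<length mu. elem_eval l x (mu ! j)))"
    by (intro sum.cong refl) (simp add: mu prod_elem_eval_expand[of _ n] sum_distrib_left)
  finally show ?thesis .
qed

subsection \<open>Colourings of spiders\<close>

text \<open>Trees are encoded by a parent map with \<open>par v < v\<close> for \<open>v > 0\<close>, so that the last vertex
  is always a leaf and can be summed out.\<close>

definition tree_sum ::
  "(nat \<Rightarrow> nat) \<Rightarrow> nat \<Rightarrow> (nat \<Rightarrow> 'a) \<Rightarrow> nat \<Rightarrow> ((nat \<Rightarrow> nat) \<Rightarrow> 'a) \<Rightarrow> 'a::comm_ring_1" where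
  "tree_sum par l x n F =
     (\<Sum>\<kappa> \<in> {\<kappa> \<in> {0..<n} \<rightarrow>\<^sub>E {0..<l}. \<forall>v<n. v \<noteq> 0 \<longrightarrow> \<kappa> v \<noteq> \<kappa> (par v)}.
        (\<Prod>v = 0..<n. x (\<kappa> v)) * F \<kappa>)"

text \<open>Weighted count of the colourings of a path of $m$ vertices hanging below a vertex of colour
  $i$; that vertex itself is not weighted.\<close>

primrec leg_sum :: "nat \<Rightarrow> (nat \<Rightarrow> 'a) \<Rightarrow> nat \<Rightarrow> nat \<Rightarrow> 'a::comm_ring_1" where
  "leg_sum l x 0 i = 1"
| "leg_sum l x (Suc m) i = (\<Sum>j \<in> {0..<l} - {i}. x j * leg_sum l x m j)"

text \<open>The chromatic symmetric function of a path on \<open>m\<close> vertices at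
  \<open>x\<close>: an end vertex with the remaining vertices as a leg. The empty path counts 1 and
  supplies the constant term of the generating function.\<close>

primrec path_sum :: "nat \<Rightarrow> (nat \<Rightarrow> 'a) \<Rightarrow> nat \<Rightarrow> 'a::comm_ring_1" where
  "path_sum l x 0 = 1"
| "path_sum l x (Suc m) = (\<Sum>j = 0..<l. x j * leg_sum l x m j)"

text \<open>Vertex \<open>n\<close> is the parent of no earlier vertex, so its colour is constrained
  only by that of \<open>par n\<close>. The product form of the weight suffices because, while a leg
  is stripped, only its current tip and the centre carry extra factors.\<close>

lemma tree_sum_remove_last:
  assumes n: "0 < n" and par: "\<And>v. 0 < v \<Longrightarrow> par v < v"
  shows "tree_sum par l x (Suc n) (\<lambda>\<kappa>. h (\<kappa> n) * g (\<kappa> 0)) =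
    tree_sum par l x n (\<lambda>\<kappa>. (\<Sum>j \<in> {0..<l} - {\<kappa> (par n)}. x j * h j) * g (\<kappa> 0))"
proof -
  let ?K = "\<lambda>n. {\<kappa> \<in> {0..<n} \<rightarrow>\<^sub>E {0..<l}. \<forall>v<n. v \<noteq> 0 \<longrightarrow> \<kappa> v \<noteq> \<kappa> (par v)}"
  have fin: "finite (?K n)"
    by (rule finite_subset[of _ "{0..<n} \<rightarrow>\<^sub>E {0..<l}"]) (auto intro: finite_PiE)
  have "tree_sum par l x n (\<lambda>\<kappa>. (\<Sum>j \<in> {0..<l} - {\<kappa> (par n)}. x j * h j) * g (\<kappa> 0)) =
      (\<Sum>\<kappa>\<in>?K n. \<Sum>j\<in>{0..<l} - {\<kappa> (par n)}.
        (\<Prod>v = 0..<n. x (\<kappa> v)) * (x j * h j) * g (\<kappa> 0))"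
    unfolding tree_sum_def by (simp add: sum_distrib_left sum_distrib_right mult.assoc)
  also have "\<dots> = (\<Sum>(\<kappa>, j) \<in> Sigma (?K n) (\<lambda>\<kappa>. {0..<l} - {\<kappa> (par n)}).
        (\<Prod>v = 0..<n. x (\<kappa> v)) * (x j * h j) * g (\<kappa> 0))"
    by (rule sum.Sigma) (use fin in auto)
  also have "\<dots> = (\<Sum>\<kappa>\<in>?K (Suc n). (\<Prod>v = 0..<Suc n. x (\<kappa> v)) * (h (\<kappa> n) * g (\<kappa> 0)))"
  \<comment> \<open>Colourings are extensional, so deleting the last vertex has to reset its value
    to \<open>undefined\<close>.\<close>
  proof (rule sum.reindex_bij_witness[where
        i = "\<lambda>\<kappa>. (\<kappa>(n := undefined), \<kappa> n)" and j = "\<lambda>(\<kappa>, j). \<kappa>(n := j)"])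
    fix p assume p: "p \<in> Sigma (?K n) (\<lambda>\<kappa>. {0..<l} - {\<kappa> (par n)})"
    obtain \<kappa> j where p': "p = (\<kappa>, j)" by fastforce
    with p have k: "\<kappa> \<in> {0..<n} \<rightarrow>\<^sub>E {0..<l}" "\<And>v. v < n \<Longrightarrow> v \<noteq> 0 \<Longrightarrow> \<kappa> v \<noteq> \<kappa> (par v)"
      and j: "j < l" "j \<noteq> \<kappa> (par n)" by auto
    have "\<kappa> n = undefined" by (rule PiE_arb[OF k(1)]) simp
    then show "(((case p of (\<kappa>, j) \<Rightarrow> \<kappa>(n := j)))(n := undefined), (case p of (\<kappa>, j) \<Rightarrow> \<kappa>(n := j)) n) = p"
      by (simp add: p' fun_upd_idem)
    have "\<kappa>(n := j) \<in> insert n {0..<n} \<rightarrow>\<^sub>E {0..<l}"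
      using k(1) j by (intro PiE_fun_upd) auto
    moreover have "(\<kappa>(n := j)) v \<noteq> (\<kappa>(n := j)) (par v)" if "v < Suc n" "v \<noteq> 0" for v
      using k(2)[of v] j par[of v] that by (cases "v = n") auto
    ultimately show "(case p of (\<kappa>, j) \<Rightarrow> \<kappa>(n := j)) \<in> ?K (Suc n)"
      by (simp add: p' atLeast0_lessThan_Suc)
    have "(\<Prod>v = 0..<n. x ((\<kappa>(n := j)) v)) = (\<Prod>v = 0..<n. x (\<kappa> v))"
      by (rule prod.cong) auto
    then show "(\<Prod>v = 0..<Suc n. x ((case p of (\<kappa>, j) \<Rightarrow> \<kappa>(n := j)) v)) *
        (h ((case p of (\<kappa>, j) \<Rightarrow> \<kappa>(n := j)) n) * g ((case p of (\<kappa>, j) \<Rightarrow> \<kappa>(n := j)) 0)) =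
        (case p of (\<kappa>, j) \<Rightarrow> (\<Prod>v = 0..<n. x (\<kappa> v)) * (x j * h j) * g (\<kappa> 0))"
      using n by (simp add: p' mult_ac)
  next
    fix \<kappa> assume k: "\<kappa> \<in> ?K (Suc n)"
    then have k1: "\<kappa> \<in> insert n {0..<n} \<rightarrow>\<^sub>E {0..<l}" by (simp add: atLeast0_lessThan_Suc)
    show "(case (\<kappa>(n := undefined), \<kappa> n) of (\<kappa>, j) \<Rightarrow> \<kappa>(n := j)) = \<kappa>" by simp
    have "\<kappa>(n := undefined) \<in> {0..<n} \<rightarrow>\<^sub>E {0..<l}"
      by (rule fun_upd_in_PiE[OF _ k1]) simp
    moreover have "(\<kappa>(n := undefined)) v \<noteq> (\<kappa>(n := undefined)) (par v)" if "v < n" "v \<noteq> 0" for v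
      using k par[of v] that by auto
    moreover have "\<kappa> n \<in> {0..<l}" "\<kappa> n \<noteq> \<kappa> (par n)" using k n by auto
    ultimately show "(\<kappa>(n := undefined), \<kappa> n) \<in> Sigma (?K n) (\<lambda>\<kappa>. {0..<l} - {\<kappa> (par n)})"
      using par[OF n] by auto
  qed
  finally show ?thesis
    by (simp add: tree_sum_def)
qed

text \<open>The leg is consumed from its tip; each removal turns the weight at the tip into the next
  \<open>leg_sum\<close> at its parent, until the centre is reached.\<close>

lemma tree_sum_remove_leg:
  assumes s: "0 < s" and par: "\<And>v. 0 < v \<Longrightarrow> par v < v"
    and leg: "\<And>i. i < m \<Longrightarrow> par (s + i) = (if i = 0 then 0 else s + i - 1)"
  shows "tree_sum par l x (s + m) (\<lambda>\<kappa>. g (\<kappa> 0)) =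
    tree_sum par l x s (\<lambda>\<kappa>. leg_sum l x m (\<kappa> 0) * g (\<kappa> 0))"
proof -
  \<comment> \<open>Generalised for the induction: \<open>k\<close> vertices have already been
    removed and are recorded as a weight at the current tip. With no vertex left the tip is the
    centre 0.\<close>
  have "tree_sum par l x (s + m) (\<lambda>\<kappa>. leg_sum l x k (\<kappa> (if m = 0 then 0 else s + m - 1)) * g (\<kappa> 0)) =
      tree_sum par l x s (\<lambda>\<kappa>. leg_sum l x (k + m) (\<kappa> 0) * g (\<kappa> 0))" for k
    using leg
  proof (induction m arbitrary: k)
    case 0
    then show ?case by simp
  next
    case (Suc m)
    have "tree_sum par l x (Suc (s + m)) (\<lambda>\<kappa>. leg_sum l x k (\<kappa> (s + m)) * g (\<kappa> 0)) =
        tree_sum par l x (s + m) (\<lambda>\<kappa>. leg_sum l x (Suc k) (\<kappa> (par (s + m))) * g (\<kappa> 0))"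
      using tree_sum_remove_last[of "s + m" par l x "leg_sum l x k" g] s par by simp
    also have "\<dots> = tree_sum par l x s (\<lambda>\<kappa>. leg_sum l x (Suc k + m) (\<kappa> 0) * g (\<kappa> 0))"
      using Suc.IH[of "Suc k"] Suc.prems by (simp del: leg_sum.simps)
    finally show ?case by (simp del: leg_sum.simps)
  qed
  from this[of 0] show ?thesis by simp
qed

lemma tree_sum_1: "tree_sum par l x (Suc 0) (\<lambda>\<kappa>. g (\<kappa> 0)) = (\<Sum>i = 0..<l. x i * g i)"
proof -
  have "{\<kappa> \<in> {0..<Suc 0} \<rightarrow>\<^sub>E {0..<l}. \<forall>v<Suc 0. v \<noteq> 0 \<longrightarrow> \<kappa> v \<noteq> \<kappa> (par v)} =
      {0} \<rightarrow>\<^sub>E {0..<l}"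
    by simp
  also have "\<dots> = (\<Union>i\<in>{0..<l}. {\<lambda>v\<in>{0}. i})"
    by (rule PiE_over_singleton_iff)
  also have "\<dots> = (\<lambda>i. \<lambda>v\<in>{0}. i) ` {0..<l}"
    by (rule UNION_singleton_eq_range)
  finally have K: "{\<kappa> \<in> {0..<Suc 0} \<rightarrow>\<^sub>E {0..<l}. \<forall>v<Suc 0. v \<noteq> 0 \<longrightarrow> \<kappa> v \<noteq> \<kappa> (par v)} =
      (\<lambda>i. \<lambda>v\<in>{0}. i) ` {0..<l}" .
  have inj: "inj_on (\<lambda>i. \<lambda>v\<in>{0}. i) {0..<l}"
    by (rule inj_onI) (metis restrict_apply' singletonI)
  show ?thesis
    unfolding tree_sum_def K by (subst sum.reindex[OF inj]) simp
qed

lemma spider_adj_iff_parent: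
  assumes "u < a + b + c + 1" "v < a + b + c + 1" "0 < a" "0 < b" "0 < c"
  defines "par \<equiv> \<lambda>v. if v = 1 \<or> v = a + 1 \<or> v = a + b + 1 then 0 else v - 1"
  shows "spider_adj a b c u v \<longleftrightarrow> (v \<noteq> 0 \<and> u = par v) \<or> (u \<noteq> 0 \<and> v = par u)"
proof -
  have "(u, v) \<in> spider_edges a b c \<longleftrightarrow> v \<noteq> 0 \<and> u = par v" if "v < a + b + c + 1" for u v
    using that assms(3-5) unfolding spider_edges_def par_def by auto
  then show ?thesis
    using assms(1,2) by (simp add: spider_adj_def)
qed

text \<open>Here \<open>i\<close> is the colour of the centre. This form is visibly symmetric in the
  legs and admits legs of length 0, both of which the recursions below exploit.\<close>

definition spider_sum :: "nat \<Rightarrow> (nat \<Rightarrow> 'a) \<Rightarrow> nat \<Rightarrow> nat \<Rightarrow> nat \<Rightarrow> 'a::comm_ring_1" where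
  "spider_sum l x a b c =
     (\<Sum>i = 0..<l. x i * (leg_sum l x a i * (leg_sum l x b i * leg_sum l x c i)))"

lemma chrom_eval_spider:
  assumes "0 < a" "0 < b" "0 < c"
  shows "chrom_eval (a + b + c + 1) (spider_adj a b c) l x = spider_sum l x a b c"
proof -
  define par where "par = (\<lambda>v. if v = 1 \<or> v = a + 1 \<or> v = a + b + 1 then 0 else v - 1)"
  let ?n = "a + b + c + 1"
  have par_less: "par v < v" if "0 < v" for v
    using that by (auto simp: par_def)
  have adj: "spider_adj a b c u v \<longleftrightarrow> (v \<noteq> 0 \<and> u = par v) \<or> (u \<noteq> 0 \<and> v = par u)"
    if "u < ?n" "v < ?n" for u v
    using spider_adj_iff_parent[OF that assms] by (simp add: par_def)
  have "(\<forall>u<?n. \<forall>v<?n. spider_adj a b c u v \<longrightarrow> \<kappa> u \<noteq> \<kappa> v) \<longleftrightarrow>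
      (\<forall>v<?n. v \<noteq> 0 \<longrightarrow> \<kappa> v \<noteq> \<kappa> (par v))" for \<kappa> :: "nat \<Rightarrow> nat"
  proof safe
    fix v assume *: "\<forall>u<?n. \<forall>v<?n. spider_adj a b c u v \<longrightarrow> \<kappa> u \<noteq> \<kappa> v"
      and v: "v < ?n" "0 < v" and eq: "\<kappa> v = \<kappa> (par v)"
    have "par v < ?n" using par_less[OF v(2)] v by simp
    then show False using *[rule_format, of "par v" v] v eq adj[of "par v" v] by simp
  next
    fix u v assume *: "\<forall>v<?n. v \<noteq> 0 \<longrightarrow> \<kappa> v \<noteq> \<kappa> (par v)"
      and uv: "u < ?n" "v < ?n" "spider_adj a b c u v" "\<kappa> u = \<kappa> v"
    show False using adj[OF uv(1,2)] uv * by metis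
  qed
  then have "chrom_eval ?n (spider_adj a b c) l x = tree_sum par l x ?n (\<lambda>\<kappa>. 1)"
    unfolding chrom_eval_def tree_sum_def by simp
  also have "\<dots> = tree_sum par l x (a + b + 1) (\<lambda>\<kappa>. leg_sum l x c (\<kappa> 0) * 1)"
    using tree_sum_remove_leg[of "a + b + 1" par c l x "\<lambda>_. 1"] par_less
    by (auto simp: par_def add_ac)
  also have "\<dots> = tree_sum par l x (a + 1) (\<lambda>\<kappa>. leg_sum l x b (\<kappa> 0) * leg_sum l x c (\<kappa> 0))"
    using tree_sum_remove_leg[of "a + 1" par b l x "leg_sum l x c"] par_less
    by (auto simp: par_def add_ac)
  also have "\<dots> = tree_sum par l x (Suc 0)
      (\<lambda>\<kappa>. leg_sum l x a (\<kappa> 0) * (leg_sum l x b (\<kappa> 0) * leg_sum l x c (\<kappa> 0)))"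
    using tree_sum_remove_leg[of 1 par a l x "\<lambda>i. leg_sum l x b i * leg_sum l x c i"] par_less
    by (auto simp: par_def add_ac)
  also have "\<dots> = spider_sum l x a b c"
    unfolding spider_sum_def
    by (rule tree_sum_1[where g = "\<lambda>i. leg_sum l x a i * (leg_sum l x b i * leg_sum l x c i)"])
  finally show ?thesis .
qed

section \<open>Spiders in terms of paths\<close>

lemma leg_sum_Suc_eq:
  assumes "i < l"
  shows "leg_sum l x (Suc m) i = path_sum l x (Suc m) - x i * leg_sum l x m i"
  using assms by (simp add: sum_diff1)

text \<open>With $q_m = $ \<open>leg_sum l x m i\<close> and $q_{m+1} = P_{m+1} - x_i q_m$, lengthening the leg $c$ or
  the leg $b$ produces the same sum $-\sum_i x_i^2 q_a q_b q_c$ beside the path products.\<close>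

lemma spider_sum_swap:
  "spider_sum l x a b (Suc c) = spider_sum l x a (Suc b) c +
     path_sum l x (Suc c) * spider_sum l x a b 0 - path_sum l x (Suc b) * spider_sum l x a 0 c"
  unfolding spider_sum_def sum_distrib_left sum.distrib[symmetric] sum_subtractf[symmetric]
  by (rule sum.cong[OF refl])
    (simp add: leg_sum_Suc_eq algebra_simps del: leg_sum.simps(2) path_sum.simps(2))

lemma spider_sum_commute: "spider_sum l x a b c = spider_sum l x b c a"
  by (simp add: spider_sum_def mult_ac)

text \<open>When one leg is empty the two path products in the swap identity cancel, so vertices can
  be moved from one leg to the other until a single leg remains.\<close>

lemma spider_sum_two_legs: "spider_sum l x a b 0 = path_sum l x (Suc (a + b))"
proof (induction b arbitrary: a)
  case 0
  then show ?case by (simp add: spider_sum_def)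
next
  case (Suc b)
  have one_leg: "spider_sum l x 0 m 0 = path_sum l x (Suc m)"
    "spider_sum l x 0 0 m = path_sum l x (Suc m)" for m
    by (simp_all add: spider_sum_def)
  have "spider_sum l x a (Suc b) 0 = spider_sum l x 0 a (Suc b)"
    by (simp add: spider_sum_def mult_ac)
  also have "\<dots> = spider_sum l x 0 (Suc a) b"
    unfolding spider_sum_swap one_leg by (simp del: path_sum.simps(2))
  also have "\<dots> = spider_sum l x (Suc a) b 0"
    by (rule spider_sum_commute)
  also have "\<dots> = path_sum l x (Suc (a + Suc b))"
    using Suc.IH[of "Suc a"] by simp
  finally show ?case .
qed

text \<open>Two swaps move the two vertices of the third leg onto the leg \<open>b\<close>; each
  contributes one positive and one negative path product.\<close>

lemma spider_sum_two:
  "spider_sum l x a b 2 = path_sum l x (a + b + 3) + path_sum l x 1 * path_sum l x (a + b + 2) +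
     path_sum l x 2 * path_sum l x (a + b + 1) -
     path_sum l x (b + 1) * path_sum l x (a + 2) - path_sum l x (b + 2) * path_sum l x (a + 1)"
proof -
  have sw: "spider_sum l x a 0 c = path_sum l x (Suc (a + c))" for c
    using spider_sum_two_legs[of l x a c] by (simp add: spider_sum_def mult_ac)
  show ?thesis
    unfolding numeral_2_eq_2 spider_sum_swap sw spider_sum_two_legs
    by (simp add: eval_nat_numeral algebra_simps del: path_sum.simps(2))
qed

section \<open>The generating function of the paths\<close>

lemma coeff_prod_elem_eval: "coeff (\<Prod>i = 0..<l. [:1, x i:]) k = elem_eval l x k"
proof -
  have "(\<Prod>i = 0..<l. [:1, x i:]) = (\<Prod>i = 0..<l. monom (x i) 1 + 1)"
    by (intro prod.cong) (simp_all add: monom_Suc monom_0 one_pCons)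
  also have "\<dots> = (\<Sum>S\<in>Pow {0..<l}. (\<Prod>i\<in>S. monom (x i) 1) * (\<Prod>i\<in>{0..<l} - S. 1))"
    by (rule prod_add) simp
  also have "\<dots> = (\<Sum>S\<in>Pow {0..<l}. monom (\<Prod>i\<in>S. x i) (card S))"
  proof (rule sum.cong[OF refl])
    fix S assume "S \<in> Pow {0..<l}"
    then have "finite S" by (auto intro: finite_subset)
    then have "(\<Prod>i\<in>S. monom (x i) 1) = monom (\<Prod>i\<in>S. x i) (card S)"
      by induction (simp_all add: mult_monom)
    then show "(\<Prod>i\<in>S. monom (x i) 1) * (\<Prod>i\<in>{0..<l} - S. 1) = monom (\<Prod>i\<in>S. x i) (card S)"
      by simp
  qed
  finally have "coeff (\<Prod>i = 0..<l. [:1, x i:]) k =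
      (\<Sum>S\<in>Pow {0..<l}. if card S = k then \<Prod>i\<in>S. x i else 0)"
    by (simp add: coeff_sum)
  also have "\<dots> = elem_eval l x k"
    unfolding elem_eval_def by (rule sum.inter_filter[symmetric]) simp
  finally show ?thesis .
qed

text \<open>Let \<open>?L i\<close> generate the leg sums below colour i. The leg recursion says (1
  + x_i z) L_i = P, and the definition of \<open>path_sum\<close> says P = 1 + z S with S = sum of
  x_i L_i. By the product rule Q' P = Q S, and eliminating S gives the identity. It is stated
  without division, as (Q - z Q') P = Q rearranged.\<close>

lemma path_sum_fps:
  fixes x :: "nat \<Rightarrow> 'a::idom" and l :: nat
  defines "Q \<equiv> fps_of_poly (\<Prod>i = 0..<l. [:1, x i:])"
  shows "Q * Abs_fps (path_sum l x) = Q + fps_X * fps_deriv Q * Abs_fps (path_sum l x)"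
proof -
  let ?P = "Abs_fps (path_sum l x)"
  let ?L = "\<lambda>i. Abs_fps (\<lambda>m. leg_sum l x m i)"
  let ?f = "\<lambda>i. fps_of_poly [:1, x i:]"
  have f: "?f i = 1 + fps_const (x i) * fps_X" for i
    by (simp add: fps_of_poly_pCons)
  have L: "?f i * ?L i = ?P" if "i < l" for i
  proof (rule fps_ext)
    fix m
    show "(?f i * ?L i) $ m = ?P $ m"
      using leg_sum_Suc_eq[OF that, of x]
      by (cases m) (simp_all add: f distrib_right mult.assoc del: leg_sum.simps(2) path_sum.simps(2))
  qed
  define S where "S = (\<Sum>i = 0..<l. fps_const (x i) * ?L i)"
  have P: "?P = 1 + fps_X * S"
  proof (rule fps_ext)
    fix m show "?P $ m = (1 + fps_X * S) $ m"
      by (cases m) (simp_all add: fps_sum_nth S_def)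
  qed
  have Q: "Q = (\<Prod>i = 0..<l. ?f i)"
    by (simp add: Q_def fps_of_poly_prod)
  have "fps_deriv Q = fps_of_poly (\<Sum>i = 0..<l. (\<Prod>j\<in>{0..<l} - {i}. [:1, x j:]) * pderiv [:1, x i:])"
    unfolding Q_def fps_of_poly_pderiv[symmetric] pderiv_prod ..
  also have "\<dots> = (\<Sum>i = 0..<l. (\<Prod>j\<in>{0..<l} - {i}. ?f j) * fps_const (x i))"
    by (simp add: fps_of_poly_sum fps_of_poly_mult fps_of_poly_prod pderiv_pCons fps_of_poly_smult mult.commute)
  finally have "fps_deriv Q * ?P =
      (\<Sum>i = 0..<l. (\<Prod>j\<in>{0..<l} - {i}. ?f j) * fps_const (x i) * ?P)"
    by (simp add: sum_distrib_right)
  also have "\<dots> = (\<Sum>i = 0..<l. Q * (fps_const (x i) * ?L i))"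
  proof (rule sum.cong[OF refl])
    fix i assume i: "i \<in> {0..<l}"
    then have Q': "Q = ?f i * (\<Prod>j\<in>{0..<l} - {i}. ?f j)"
      unfolding Q by (intro prod.remove) auto
    have P': "?P = ?f i * ?L i"
      using L i by simp
    show "(\<Prod>j\<in>{0..<l} - {i}. ?f j) * fps_const (x i) * ?P = Q * (fps_const (x i) * ?L i)"
      by (simp only: Q' P' mult_ac)
  qed
  also have "\<dots> = Q * S"
    by (simp only: S_def sum_distrib_left)
  finally have "Q + fps_X * fps_deriv Q * ?P = Q * (1 + fps_X * S)"
    by (simp add: mult.assoc distrib_left mult.left_commute)
  then show ?thesis
    using P by metis
qed

text \<open>Coefficient of z^m in the identity above: the term k = 0, with e_0 = 1, isolates P_m,
  and subtracting z Q' produces the weights k - 1.\<close>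

lemma path_sum_rec:
  fixes x :: "nat \<Rightarrow> 'a::idom"
  shows "path_sum l x m = elem_eval l x m +
    (\<Sum>k = 1..m. (of_nat k - 1) * elem_eval l x k * path_sum l x (m - k))"
proof -
  let ?P = "Abs_fps (path_sum l x)"
  define Q where "Q = fps_of_poly (\<Prod>i = 0..<l. [:1, x i:])"
  have Q: "Q $ k = elem_eval l x k" for k
    unfolding Q_def fps_of_poly_nth coeff_prod_elem_eval ..
  define R where "R = fps_X * fps_deriv Q"
  have R: "R $ k = of_nat k * elem_eval l x k" for k
    unfolding R_def by (cases k) (simp_all add: Q)
  have "(Q * ?P) $ m = (Q + R * ?P) $ m"
    unfolding Q_def R_def path_sum_fps[of x l] by simp
  then have "(\<Sum>k = 0..m. elem_eval l x k * path_sum l x (m - k)) =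
      elem_eval l x m + (\<Sum>k = 0..m. of_nat k * elem_eval l x k * path_sum l x (m - k))"
    unfolding fps_add_nth fps_mult_nth Q R by simp
  moreover have "elem_eval l x 0 = 1"
  proof -
    have "{S \<in> Pow {0..<l}. card S = 0} = {{}}"
      by (auto dest: finite_subset)
    then show ?thesis by (simp add: elem_eval_def)
  qed
  ultimately show ?thesis
    by (simp add: sum.atLeast_Suc_atMost[of 0 m] algebra_simps sum_subtractf)
qed

subsection \<open>Nonnegative specialisations\<close>

text \<open>Coefficients of $E(z) / (E(z) - z E'(z))$, where $e$ is the coefficient sequence of $E$.\<close>

fun path_coeff :: "(nat \<Rightarrow> real) \<Rightarrow> nat \<Rightarrow> real" where
  "path_coeff e m = e m + (\<Sum>k = 1..m. (real k - 1) * e k * path_coeff e (m - k))"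

declare path_coeff.simps [simp del]

text \<open>The recursion sees the points only through their elementary symmetric values, so complex
  points with real e_k give real path values.\<close>

lemma path_sum_eq_path_coeff:
  fixes x :: "nat \<Rightarrow> complex"
  assumes e: "\<And>k. elem_eval l x k = of_real (e k)"
  shows "path_sum l x m = of_real (path_coeff e m)"
proof (induction m rule: less_induct)
  case (less m)
  have "(\<Sum>k = 1..m. (of_nat k - 1) * elem_eval l x k * path_sum l x (m - k)) =
      (\<Sum>k = 1..m. of_real ((real k - 1) * e k * path_coeff e (m - k)))"
    by (rule sum.cong[OF refl]) (use less in \<open>simp add: e\<close>)
  then show ?case
    by (subst path_sum_rec, subst path_coeff.simps) (simp add: e)
qed

text \<open>Over the complex numbers the polynomial splits. Constant term 1 excludes the root 0, so
  each factor z - y rescales to 1 - z / y, and the points are x = -1 / y.\<close>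

lemma exists_elem_eval_eq_coeff:
  fixes Q :: "real poly"
  assumes Q0: "coeff Q 0 = 1"
  obtains l and x :: "nat \<Rightarrow> complex" where "\<And>k. elem_eval l x k = of_real (coeff Q k)"
proof -
  define p :: "complex poly" where "p = map_poly of_real Q"
  have p: "coeff p k = of_real (coeff Q k)" for k
    by (simp add: p_def coeff_map_poly)
  have "p \<noteq> 0"
    using p[of 0] Q0 by auto
  then obtain A where "p = smult (lead_coeff p) (\<Prod>y\<in>#A. [:-y, 1:])"
    using alg_closed_imp_factorization by blast
  moreover obtain ys where "mset ys = A"
    using ex_mset by blast
  ultimately have fact: "p = smult (lead_coeff p) (\<Prod>y\<leftarrow>ys. [:-y, 1:])"
    by (metis mset_map prod_mset_prod_list)
  have nz: "0 \<notin> set ys"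
  proof
    assume "0 \<in> set ys"
    then have "poly (\<Prod>y\<leftarrow>ys. [:-y, 1:]) 0 = 0"
      by (induction ys) auto
    then have "poly p 0 = 0"
      using fact by (metis mult_zero_right poly_smult)
    then show False
      using p[of 0] Q0 by (simp add: poly_0_coeff_0)
  qed
  define R where "R = (\<Prod>y\<leftarrow>ys. [:1, - 1 / y:])"
  have "(\<Prod>y\<leftarrow>ys. [:-y, 1:]) = smult (\<Prod>y\<leftarrow>ys. - y) R"
    using nz unfolding R_def
  proof (induction ys)
    case (Cons y ys)
    have "[:-y, 1:] = smult (- y) [:1, - 1 / y:]"
      using Cons.prems by simp
    then show ?case
      using Cons by (simp only: list.map prod_list.Cons mult_smult_left mult_smult_right smult_smult
        list.set insert_iff de_Morgan_disj simp_thms mult.commute)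
  qed simp
  then obtain c where c: "p = smult c R"
    using fact by (metis smult_smult)
  have "coeff R 0 = 1"
    unfolding R_def by (induction ys) (auto simp: coeff_mult)
  \<comment> \<open>Both polynomials have constant term 1, so no scalar is left over.\<close>
  then have "c = 1"
    using p[of 0] Q0 by (simp add: c)
  then have "p = R"
    using c by simp
  also have "\<dots> = (\<Prod>i = 0..<length ys. [:1, - 1 / ys ! i:])"
    unfolding R_def by (simp add: prod.list_conv_set_nth)
  finally show ?thesis
    using that[of "length ys" "\<lambda>i. - 1 / ys ! i"] p by (metis coeff_prod_elem_eval)
qed

lemma e_positive_spider_ineq:
  fixes Q :: "real poly"
  assumes pos: "e_positive (a + b + 2 + 1) (spider_adj a b 2)"
    and ab: "0 < a" "0 < b"
    and Q: "coeff Q 0 = 1" "\<And>k. 0 \<le> coeff Q k"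
  defines "p \<equiv> path_coeff (coeff Q)"
  shows "0 \<le> p (a + b + 3) + p 1 * p (a + b + 2) + p 2 * p (a + b + 1) -
    p (b + 1) * p (a + 2) - p (b + 2) * p (a + 1)"
proof -
  let ?n = "a + b + 2 + 1"
  obtain c where c0: "\<And>mu. mu \<in> partitions ?n \<Longrightarrow> 0 \<le> c mu"
    and c: "\<And>lam. lam \<in> partitions ?n \<Longrightarrow> real (chrom_coeff ?n (spider_adj a b 2) lam) =
      (\<Sum>mu \<in> partitions ?n. c mu * real (elem_coeff mu lam))"
    using pos unfolding e_positive_def by blast
  obtain l and x :: "nat \<Rightarrow> complex" where x: "\<And>k. elem_eval l x k = of_real (coeff Q k)"
    using exists_elem_eval_eq_coeff[OF Q(1)] by blast
  have "of_real (p (a + b + 3) + p 1 * p (a + b + 2) + p 2 * p (a + b + 1) -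
      p (b + 1) * p (a + 2) - p (b + 2) * p (a + 1)) = spider_sum l x a b 2"
    unfolding spider_sum_two path_sum_eq_path_coeff[of l x "coeff Q", OF x] p_def by simp
  also have "\<dots> = chrom_eval ?n (spider_adj a b 2) l x"
    using chrom_eval_spider[OF ab, of 2 l x] by simp
  also have "\<dots> = (\<Sum>mu \<in> partitions ?n. of_real (c mu) *
      (\<Prod>j = 0..<length mu. elem_eval l x (mu ! j)))"
    by (rule e_expansion_eval) (rule c)
  also have "\<dots> = of_real (\<Sum>mu \<in> partitions ?n. c mu * (\<Prod>j = 0..<length mu. coeff Q (mu ! j)))"
    by (simp add: x)
  finally have "p (a + b + 3) + p 1 * p (a + b + 2) + p 2 * p (a + b + 1) -
      p (b + 1) * p (a + 2) - p (b + 2) * p (a + 1) =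
      (\<Sum>mu \<in> partitions ?n. c mu * (\<Prod>j = 0..<length mu. coeff Q (mu ! j)))"
    \<comment> \<open>Both sides are real, so the complex identity descends to the real numbers,
      where signs can be read off.\<close>
    unfolding of_real_eq_iff .
  also have "\<dots> \<ge> 0"
    by (intro sum_nonneg mult_nonneg_nonneg prod_nonneg ballI c0 Q(2))
  finally show ?thesis .
qed

text \<open>Degree 4 covers every test polynomial. The weights k - 1 give the factors 1, 2, 3 and
  remove c1 from the recursion, so c1 acts only through the initial values. The last summand is the
  inhomogeneous term e_(m+4), present only for m = 0.\<close>

lemma path_coeff_quartic:
  fixes c1 c2 c3 c4 :: real
  defines "p \<equiv> path_coeff (coeff [:1, c1, c2, c3, c4:])"
  shows "p 0 = 1" "p 1 = c1" "p 2 = 2 * c2" "p 3 = 3 * c3 + c1 * c2"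
    "p (m + 4) = c2 * p (m + 2) + 2 * c3 * p (m + 1) + 3 * c4 * p m + (if m = 0 then c4 else 0)"
proof -
  note [simp] = p_def coeff_pCons eval_nat_numeral
  show p0: "p 0 = 1"
    by (subst p_def, subst path_coeff.simps) simp
  show p1: "p 1 = c1"
    by (subst p_def, subst path_coeff.simps) simp
  show p2: "p 2 = 2 * c2"
    using p0 by (subst p_def, subst path_coeff.simps) simp
  show "p 3 = 3 * c3 + c1 * c2"
    using p0 p1 by (subst p_def, subst path_coeff.simps) simp
  have "(\<Sum>k = 1..m + 4. (real k - 1) * coeff [:1, c1, c2, c3, c4:] k * p (m + 4 - k)) =
      (\<Sum>k \<in> {2, 3, 4}. (real k - 1) * coeff [:1, c1, c2, c3, c4:] k * p (m + 4 - k))"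
    by (rule sum.mono_neutral_right) (auto split: nat.splits)
  then show "p (m + 4) = c2 * p (m + 2) + 2 * c3 * p (m + 1) + 3 * c4 * p m +
      (if m = 0 then c4 else 0)"
    by (subst p_def, subst path_coeff.simps) (simp split: nat.splits)
qed

section \<open>Leading terms in the perturbation parameter\<close>

text \<open>The expansion $F(s) = v s^j + o(s^j)$ at $0$, where $v = 0$ is allowed.\<close>

definition has_lead :: "nat \<Rightarrow> real \<Rightarrow> (real \<Rightarrow> real) \<Rightarrow> bool" where
  "has_lead j v F \<longleftrightarrow> (\<exists>f. isCont f 0 \<and> f 0 = v \<and> (\<forall>s. F s = s ^ j * f s))"

lemma has_lead_const: "has_lead 0 v (\<lambda>s. v)"
  unfolding has_lead_def by (intro exI[of _ "\<lambda>s. v"]) simp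

lemma has_lead_monom: "has_lead j v (\<lambda>s. v * s ^ j)"
  unfolding has_lead_def by (intro exI[of _ "\<lambda>s. v"]) simp

lemma has_lead_add:
  assumes "has_lead j v F" "has_lead j w G"
  shows "has_lead j (v + w) (\<lambda>s. F s + G s)"
proof -
  obtain f g where "isCont f 0" "f 0 = v" "\<forall>s. F s = s ^ j * f s"
    "isCont g 0" "g 0 = w" "\<forall>s. G s = s ^ j * g s"
    using assms unfolding has_lead_def by blast
  then show ?thesis
    unfolding has_lead_def by (intro exI[of _ "\<lambda>s. f s + g s"]) (simp add: distrib_left)
qed

lemma has_lead_mult:
  assumes "has_lead i v F" "has_lead j w G"
  shows "has_lead (i + j) (v * w) (\<lambda>s. F s * G s)"
proof -
  obtain f g where "isCont f 0" "f 0 = v" "\<forall>s. F s = s ^ i * f s"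
    "isCont g 0" "g 0 = w" "\<forall>s. G s = s ^ j * g s"
    using assms unfolding has_lead_def by blast
  then show ?thesis
    unfolding has_lead_def by (intro exI[of _ "\<lambda>s. f s * g s"]) (simp add: power_add)
qed

lemma has_lead_diff:
  assumes "has_lead j v F" "has_lead j w G"
  shows "has_lead j (v - w) (\<lambda>s. F s - G s)"
  using has_lead_add[OF assms(1), of "- 1 * w" "\<lambda>s. - 1 * G s"]
    has_lead_mult[OF has_lead_const[of "- 1"] assms(2)] by simp

text \<open>Allows a term of higher order to be added to one of order \<open>j\<close> without
  affecting the leading coefficient.\<close>

lemma has_lead_weaken:
  assumes "has_lead i v F" "j < i"
  shows "has_lead j 0 F"
proof -
  obtain f where "isCont f 0" "f 0 = v" "\<forall>s. F s = s ^ i * f s"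
    using assms unfolding has_lead_def by blast
  moreover have "s ^ i = s ^ j * s ^ (i - j)" for s :: real
    using assms(2) by (simp flip: power_add)
  ultimately show ?thesis
    unfolding has_lead_def using assms(2)
    by (intro exI[of _ "\<lambda>s. s ^ (i - j) * f s"]) (simp add: mult.assoc)
qed

text \<open>Dividing by s^j > 0 preserves the sign; then s tends to 0 from the right.\<close>

lemma has_lead_nonneg:
  assumes "has_lead j v F" "\<And>s. 0 < s \<Longrightarrow> 0 \<le> F s"
  shows "0 \<le> v"
proof -
  obtain f where f: "isCont f 0" "f 0 = v" "\<forall>s. F s = s ^ j * f s"
    using assms(1) unfolding has_lead_def by blast
  have "(f \<longlongrightarrow> v) (at_right 0)"
    using f(1,2) by (metis isCont_def tendsto_within_subset subset_UNIV)
  moreover have "eventually (\<lambda>s. 0 \<le> f s) (at_right 0)"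
    unfolding eventually_at_right_field
  proof (intro exI[of _ 1] conjI allI impI)
    fix s :: real assume "0 < s"
    then have "0 < s ^ j" "0 \<le> s ^ j * f s"
      using assms(2)[of s] f(3) by simp_all
    then show "0 \<le> f s"
      by (simp add: zero_le_mult_iff)
  qed simp
  ultimately show ?thesis
    by (rule tendsto_lowerbound) simp
qed

section \<open>Path values for the test polynomials\<close>

text \<open>The recursion reduces to P_(m+3) = 2 P_m for m > 0, so each residue class modulo 3 is
  geometric with ratio 2, starting from s, 0 and 3. The value s = 0 serves 1 + z^3, and s = 1 serves
  1 + z + z^3.\<close>

lemma path_coeff_e1_e3:
  fixes s :: real
  defines "p \<equiv> path_coeff (coeff [:1, s, 0, 1, 0:])"
  shows "p (3 * k + 1) = 2 ^ k * s \<and> p (3 * k + 2) = 0 \<and> p (3 * k + 3) = 3 * 2 ^ k"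
proof (induction k)
  case 0
  show ?case using path_coeff_quartic(2-4)[of s 0 1 0, folded p_def]
    by (simp del: add_2_eq_Suc add_2_eq_Suc')
next
  case (Suc k)
  note p = path_coeff_quartic[of s 0 1 0, folded p_def]
  have "p (3 * k + 4) = 2 * p (3 * k + 1)" "p (3 * k + 5) = 2 * p (3 * k + 2)"
    "p (3 * k + 6) = 2 * p (3 * k + 3)"
    using p(5)[of "3 * k"] p(5)[of "3 * k + 1"] p(5)[of "3 * k + 2"]
    by (simp_all add: numeral_eq_Suc)
  with Suc show ?case by (simp add: numeral_eq_Suc)
qed

text \<open>The order in s is the number of factors e_2 needed to reach the index modulo 3 with
  parts 2 and 3. For residue 1 it suffices to know that the linear coefficient is 0. For residue 2
  the linear coefficient satisfies A_(k+1) = 2 A_k + 3 * 2^k with A_0 = 2.\<close>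

lemma path_coeff_e2_e3:
  defines "p \<equiv> \<lambda>s. path_coeff (coeff [:1, 0, s, 1, 0:])"
  shows "has_lead 1 0 (\<lambda>s. p s (3 * k + 1))"
    "has_lead 1 (2 ^ k * (3 * real k + 4) / 2) (\<lambda>s. p s (3 * k + 2))"
    "has_lead 0 (3 * 2 ^ k) (\<lambda>s. p s (3 * k + 3))"
proof -
  note [simp del] = add_2_eq_Suc add_2_eq_Suc'
  have "path_coeff (coeff [:1, 0, s, 1, 0:]) = p s" for s
    by (simp add: p_def)
  note p = path_coeff_quartic[of 0 _ 1 0, unfolded this]
  have rec: "p s (m + 4) = s * p s (m + 2) + 2 * p s (m + 1)"
    "p s (m + 5) = s * p s (m + 3) + 2 * p s (m + 2)"
    "p s (m + 6) = s * p s (m + 4) + 2 * p s (m + 3)" for s m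
    using p(5)[of s m] p(5)[of s "m + 1"] p(5)[of s "m + 2"] by (simp_all add: numeral_eq_Suc)
  have s: "has_lead 1 1 (\<lambda>s. s)"
    using has_lead_monom[of 1 1] by simp
  note two = has_lead_const[of 2]
  have "has_lead 1 0 (\<lambda>s. p s (3 * k + 1)) \<and>
      has_lead 1 (2 ^ k * (3 * real k + 4) / 2) (\<lambda>s. p s (3 * k + 2)) \<and>
      has_lead 0 (3 * 2 ^ k) (\<lambda>s. p s (3 * k + 3))"
  proof (induction k)
    case 0
    show ?case
      using p(2-4) has_lead_monom[of 1 0] has_lead_monom[of 1 2] has_lead_const[of 3] by simp
  next
    case (Suc k)
    then have IH: "has_lead 1 0 (\<lambda>s. p s (3 * k + 1))"
      "has_lead 1 (2 ^ k * (3 * real k + 4) / 2) (\<lambda>s. p s (3 * k + 2))"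
      "has_lead 0 (3 * 2 ^ k) (\<lambda>s. p s (3 * k + 3))"
      by simp_all
    from has_lead_mult[OF s IH(2)] have "has_lead 1 0 (\<lambda>s. s * p s (3 * k + 2))"
      by (rule has_lead_weaken) simp
    from has_lead_add[OF this, of "2 * 0"] has_lead_mult[OF two IH(1)]
    have 1: "has_lead 1 0 (\<lambda>s. p s (3 * k + 4))"
      unfolding rec by simp
    from has_lead_add[OF has_lead_mult[OF s IH(3)]] has_lead_mult[OF two IH(2)]
    have "has_lead 1 (1 * (3 * 2 ^ k) + 2 * (2 ^ k * (3 * real k + 4) / 2))
        (\<lambda>s. s * p s (3 * k + 3) + 2 * p s (3 * k + 2))"
      by simp
    then have 2: "has_lead 1 (2 ^ Suc k * (3 * real (Suc k) + 4) / 2) (\<lambda>s. p s (3 * k + 5))"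
      unfolding rec by (simp add: field_simps)
    from has_lead_mult[OF s 1] have "has_lead 0 0 (\<lambda>s. s * p s (3 * k + 4))"
      by (rule has_lead_weaken) simp
    from has_lead_add[OF this, of "2 * (3 * 2 ^ k)"] has_lead_mult[OF two IH(3)]
    have 3: "has_lead 0 (3 * 2 ^ Suc k) (\<lambda>s. p s (3 * k + 6))"
      unfolding rec by simp
    show ?case
      using 1 2 3 by (simp add: algebra_simps)
  qed
  then show "has_lead 1 0 (\<lambda>s. p s (3 * k + 1))"
    "has_lead 1 (2 ^ k * (3 * real k + 4) / 2) (\<lambda>s. p s (3 * k + 2))"
    "has_lead 0 (3 * 2 ^ k) (\<lambda>s. p s (3 * k + 3))"
    by simp_all
qed

text \<open>Residues 1 and 2 need one and two factors e_4. The leading coefficients satisfy B_(k+1)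
  = 2 B_k + 9 * 2^k with B_0 = 4, and C_(k+1) = 2 C_k + 3 B_k with C_0 = 0; the closed form for C is
  therefore 2^k times a quadratic in k.\<close>

lemma path_coeff_e3_e4:
  defines "p \<equiv> \<lambda>s. path_coeff (coeff [:1, 0, 0, 1, s:])"
  shows "has_lead 0 (3 * 2 ^ k) (\<lambda>s. p s (3 * k + 3))"
    "has_lead 1 (2 ^ k * (9 * real k + 8) / 2) (\<lambda>s. p s (3 * k + 4))"
    "has_lead 2 (2 ^ k * real k * (27 * real k + 21) / 8) (\<lambda>s. p s (3 * k + 5))"
proof -
  note [simp del] = add_2_eq_Suc add_2_eq_Suc'
  have "path_coeff (coeff [:1, 0, 0, 1, s:]) = p s" for s
    by (simp add: p_def)
  note p = path_coeff_quartic[of 0 0 1, unfolded this]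
  have rec: "p s (m + 5) = 2 * p s (m + 2) + 3 * s * p s (m + 1)"
    "p s (m + 6) = 2 * p s (m + 3) + 3 * s * p s (m + 2)"
    "p s (m + 7) = 2 * p s (m + 4) + 3 * s * p s (m + 3)"
    "p s (m + 8) = 2 * p s (m + 5) + 3 * s * p s (m + 4)" for s m
    using p(5)[of s "m + 1"] p(5)[of s "m + 2"] p(5)[of s "m + 3"] p(5)[of s "m + 4"]
    by (simp_all add: numeral_eq_Suc)
  have s: "has_lead 1 3 (\<lambda>s. 3 * s)"
    using has_lead_monom[of 1 3] by simp
  note two = has_lead_const[of 2]
  \<comment> \<open>The first conjunct is added for the induction: it makes the e_4 contribution to
    index 3k + 6 negligible.\<close>
  have "has_lead 0 0 (\<lambda>s. p s (3 * k + 2)) \<and>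
      has_lead 0 (3 * 2 ^ k) (\<lambda>s. p s (3 * k + 3)) \<and>
      has_lead 1 (2 ^ k * (9 * real k + 8) / 2) (\<lambda>s. p s (3 * k + 4)) \<and>
      has_lead 2 (2 ^ k * real k * (27 * real k + 21) / 8) (\<lambda>s. p s (3 * k + 5))"
  proof (induction k)
    case 0
    have "p s 4 = 4 * s" "p s 5 = 0" for s
      using p(5)[of s 0] rec(1)[of s 0] p(1-3)[of s] by simp_all
    then show ?case
      using p(3,4) has_lead_monom[of 1 4] has_lead_monom[of 2 0] has_lead_const[of 3]
        has_lead_const[of 0] by simp
  next
    case (Suc k)
    then have IH: "has_lead 0 0 (\<lambda>s. p s (3 * k + 2))"
      "has_lead 0 (3 * 2 ^ k) (\<lambda>s. p s (3 * k + 3))"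
      "has_lead 1 (2 ^ k * (9 * real k + 8) / 2) (\<lambda>s. p s (3 * k + 4))"
      "has_lead 2 (2 ^ k * real k * (27 * real k + 21) / 8) (\<lambda>s. p s (3 * k + 5))"
      by simp_all
    from has_lead_mult[OF s IH(1)] have "has_lead 0 0 (\<lambda>s. 3 * s * p s (3 * k + 2))"
      by (rule has_lead_weaken) simp
    from has_lead_add[OF _ this, of "2 * (3 * 2 ^ k)"] has_lead_mult[OF two IH(2)]
    have 1: "has_lead 0 (3 * 2 ^ Suc k) (\<lambda>s. p s (3 * k + 6))"
      unfolding rec by simp
    from has_lead_add[OF _ has_lead_mult[OF s IH(2)]] has_lead_mult[OF two IH(3)]
    have "has_lead 1 (2 * (2 ^ k * (9 * real k + 8) / 2) + 3 * (3 * 2 ^ k))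
        (\<lambda>s. 2 * p s (3 * k + 4) + 3 * s * p s (3 * k + 3))"
      by simp
    then have 2: "has_lead 1 (2 ^ Suc k * (9 * real (Suc k) + 8) / 2) (\<lambda>s. p s (3 * k + 7))"
      unfolding rec by (simp add: field_simps)
    from has_lead_add[OF _ has_lead_mult[OF s IH(3), unfolded one_add_one]] has_lead_mult[OF two IH(4)]
    have "has_lead 2 (2 * (2 ^ k * real k * (27 * real k + 21) / 8) +
          3 * (2 ^ k * (9 * real k + 8) / 2))
        (\<lambda>s. 2 * p s (3 * k + 5) + 3 * s * p s (3 * k + 4))"
      by simp
    moreover have "2 * (2 ^ k * real k * (27 * real k + 21) / 8) +
        3 * (2 ^ k * (9 * real k + 8) / 2) =
        2 ^ Suc k * real (Suc k) * (27 * real (Suc k) + 21) / 8"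
      by (simp add: field_simps)
    ultimately have 3: "has_lead 2 (2 ^ Suc k * real (Suc k) * (27 * real (Suc k) + 21) / 8)
        (\<lambda>s. p s (3 * k + 8))"
      unfolding rec(4) by (simp only:)
    from IH(4) have 4: "has_lead 0 0 (\<lambda>s. p s (3 * k + 5))"
      by (rule has_lead_weaken) simp
    show ?case
      using 1 2 3 4 by (simp add: algebra_simps)
  qed
  then show "has_lead 0 (3 * 2 ^ k) (\<lambda>s. p s (3 * k + 3))"
    "has_lead 1 (2 ^ k * (9 * real k + 8) / 2) (\<lambda>s. p s (3 * k + 4))"
    "has_lead 2 (2 ^ k * real k * (27 * real k + 21) / 8) (\<lambda>s. p s (3 * k + 5))"
    by simp_all
qed

subsection \<open>The excluded residue classes\<close>

text \<open>Exactly one of the two subtracted products has both indices divisible by 3. It equals 9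
  * 2^(x+y), against 6 * 2^(x+y) from P_(a+b+3).\<close>

lemma not_e_positive_spider_sum_multiple_of_3:
  assumes "a = 3 * x + 2 \<and> b = 3 * y + 1 \<or> a = 3 * x + 1 \<and> b = 3 * y + 2"
  shows "\<not> e_positive (a + b + 2 + 1) (spider_adj a b 2)"
proof
  assume pos: "e_positive (a + b + 2 + 1) (spider_adj a b 2)"
  define p where "p = path_coeff (coeff [:1, 0, 0, 1, 0:])"
  have "0 \<le> p (a + b + 3) + p 1 * p (a + b + 2) + p 2 * p (a + b + 1) -
      p (b + 1) * p (a + 2) - p (b + 2) * p (a + 1)"
    unfolding p_def
    by (rule e_positive_spider_ineq[OF pos])
      (use assms in \<open>auto simp: coeff_pCons split: nat.splits\<close>)
  moreover have "p 1 = 0" "p 2 = 0"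
    unfolding p_def by (simp_all only: path_coeff_quartic)
  moreover have p: "p (3 * k + 1) = 0" "p (3 * k + 2) = 0" "p (3 * k + 3) = 3 * 2 ^ k" for k
    using path_coeff_e1_e3[of 0 k] by (simp_all add: p_def)
  moreover have "p (a + b + 3) = 3 * 2 ^ (x + y + 1)"
    using assms p(3)[of "x + y + 1"] by (auto simp: algebra_simps)
  moreover have "p (b + 1) * p (a + 2) + p (b + 2) * p (a + 1) = 9 * 2 ^ (x + y)"
    using assms
  proof
    assume "a = 3 * x + 2 \<and> b = 3 * y + 1"
    then show ?thesis
      using p(2)[of y] p(3)[of y] p(3)[of x] by (simp add: numeral_eq_Suc power_add)
  next
    assume "a = 3 * x + 1 \<and> b = 3 * y + 2"
    then show ?thesis
      using p(2)[of x] p(3)[of y] p(3)[of x] by (simp add: numeral_eq_Suc power_add)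
  qed
  ultimately have "9 * 2 ^ (x + y) \<le> (6 * 2 ^ (x + y) :: real)"
    by (simp add: algebra_simps)
  then show False
    by simp
qed

text \<open>In units of 2^(x+y) the surviving terms are 4 + 6 - 6 - 6 = -2.\<close>

lemma not_e_positive_spider_2_2:
  assumes "a = 3 * x + 2" "b = 3 * y + 2"
  shows "\<not> e_positive (a + b + 2 + 1) (spider_adj a b 2)"
proof
  assume pos: "e_positive (a + b + 2 + 1) (spider_adj a b 2)"
  define p where "p = path_coeff (coeff [:1, 1, 0, 1, 0:])"
  have "0 \<le> p (a + b + 3) + p 1 * p (a + b + 2) + p 2 * p (a + b + 1) -
      p (b + 1) * p (a + 2) - p (b + 2) * p (a + 1)"
    unfolding p_def
    by (rule e_positive_spider_ineq[OF pos])
      (use assms in \<open>auto simp: coeff_pCons split: nat.splits\<close>)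
  moreover have "p 1 = 1" "p 2 = 0"
    unfolding p_def by (simp_all only: path_coeff_quartic)
  moreover have p: "p (3 * k + 1) = 2 ^ k" "p (3 * k + 3) = 3 * 2 ^ k" for k
    using path_coeff_e1_e3[of 1 k] by (simp_all add: p_def)
  moreover have "a + b + 3 = 3 * (x + y + 2) + 1" "a + b + 2 = 3 * (x + y + 1) + 3"
    "b + 1 = 3 * y + 3" "a + 2 = 3 * (x + 1) + 1" "b + 2 = 3 * (y + 1) + 1" "a + 1 = 3 * x + 3"
    using assms by simp_all
  ultimately have "0 \<le> 2 ^ (x + y + 2) + 1 * (3 * 2 ^ (x + y + 1)) + 0 * p (a + b + 1) -
      3 * 2 ^ y * 2 ^ (x + 1) - 2 ^ (y + 1) * (3 * 2 ^ x)"
    by (simp only:)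
  then have "2 ^ x * 2 ^ y \<le> (0 :: real)"
    by (simp add: power_add algebra_simps)
  moreover have "0 < 2 ^ x * (2 ^ y :: real)"
    by simp
  ultimately show False
    by linarith
qed

lemma not_e_positive_spider_1_1:
  assumes a: "a = 3 * x + 1" and b: "b = 3 * y + 1" and y: "0 < y"
  shows "\<not> e_positive (a + b + 2 + 1) (spider_adj a b 2)"
proof
  assume pos: "e_positive (a + b + 2 + 1) (spider_adj a b 2)"
  define p where "p s = path_coeff (coeff [:1, 0, s, 1, 0:])" for s
  define F where "F s = p s (3 * (x + y + 1) + 2) + p s 2 * p s (3 * (x + y) + 3) -
      p s (3 * y + 2) * p s (3 * x + 3) - p s (3 * y + 3) * p s (3 * x + 2)" for s
  note lead = path_coeff_e2_e3[folded p_def]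
  have p12: "p s 1 = 0" "p s 2 = 2 * s" for s
    unfolding p_def by (simp_all only: path_coeff_quartic)
  have lead2: "has_lead 1 2 (\<lambda>s. p s 2)"
    using has_lead_monom[of 1 2] by (simp add: p12)
  let ?V = "2 ^ (x + y + 1) * (3 * real (x + y + 1) + 4) / 2 + 2 * (3 * 2 ^ (x + y)) -
      2 ^ y * (3 * real y + 4) / 2 * (3 * 2 ^ x) - 3 * 2 ^ y * (2 ^ x * (3 * real x + 4) / 2)"
  have "has_lead 1 ?V F"
    using has_lead_diff[OF has_lead_diff[OF has_lead_add[OF lead(2)[of "x + y + 1"]
      has_lead_mult[OF lead2 lead(3)[of "x + y"], unfolded add_0_right]]
      has_lead_mult[OF lead(2)[of y] lead(3)[of x], unfolded add_0_right]]
      has_lead_mult[OF lead(3)[of y] lead(2)[of x], unfolded add_0]]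
    unfolding F_def .
  moreover have "0 \<le> F s" if "0 < s" for s
  proof -
    have "0 \<le> p s (a + b + 3) + p s 1 * p s (a + b + 2) + p s 2 * p s (a + b + 1) -
        p s (b + 1) * p s (a + 2) - p s (b + 2) * p s (a + 1)"
      unfolding p_def
      by (rule e_positive_spider_ineq[OF pos])
        (use assms that in \<open>auto simp: coeff_pCons split: nat.splits\<close>)
    moreover have "a + b + 3 = 3 * (x + y + 1) + 2" "a + b + 1 = 3 * (x + y) + 3"
      "b + 1 = 3 * y + 2" "a + 2 = 3 * x + 3" "b + 2 = 3 * y + 3" "a + 1 = 3 * x + 2"
      using a b by simp_all
    ultimately show ?thesis
      by (simp only: F_def p12(1) mult_zero_left add_0_right)
  qed
  ultimately have "0 \<le> ?V"
    by (rule has_lead_nonneg)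
  \<comment> \<open>The coefficient of s is negative as soon as x + y is at least 1, which
    \<open>0 < y\<close> ensures.\<close>
  also have "?V = 2 ^ (x + y) * (1 - 3 / 2 * real (x + y))"
    by (simp add: power_add field_simps)
  finally have "0 \<le> 1 - 3 / 2 * real (x + y)"
    by (rule mult_left_le_imp_le[of "2 ^ (x + y)" 0, unfolded mult_zero_right]) simp
  then show False
    using y by simp
qed

lemma not_e_positive_spider_0_2:
  assumes a: "a = 3 * x + 3" and b: "b = 3 * y + 2" and le: "y \<le> x"
  shows "\<not> e_positive (a + b + 2 + 1) (spider_adj a b 2)"
proof
  assume pos: "e_positive (a + b + 2 + 1) (spider_adj a b 2)"
  define p where "p s = path_coeff (coeff [:1, 0, 0, 1, s:])" for s
  define F where "F s = p s (3 * (x + y + 1) + 5) - p s (3 * y + 3) * p s (3 * x + 5) -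
      p s (3 * y + 4) * p s (3 * x + 4)" for s
  note lead = path_coeff_e3_e4[folded p_def]
  have p12: "p s 1 = 0" "p s 2 = 0" for s
    unfolding p_def by (simp_all only: path_coeff_quartic)
  let ?V = "2 ^ (x + y + 1) * real (x + y + 1) * (27 * real (x + y + 1) + 21) / 8 -
      3 * 2 ^ y * (2 ^ x * real x * (27 * real x + 21) / 8) -
      2 ^ y * (9 * real y + 8) / 2 * (2 ^ x * (9 * real x + 8) / 2)"
  have "has_lead 2 ?V F"
    using has_lead_diff[OF has_lead_diff[OF lead(3)[of "x + y + 1"]
      has_lead_mult[OF lead(1)[of y] lead(3)[of x], unfolded add_0]]
      has_lead_mult[OF lead(2)[of y] lead(2)[of x], unfolded one_add_one]]
    unfolding F_def .
  moreover have "0 \<le> F s" if "0 < s" for s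
  proof -
    have "0 \<le> p s (a + b + 3) + p s 1 * p s (a + b + 2) + p s 2 * p s (a + b + 1) -
        p s (b + 1) * p s (a + 2) - p s (b + 2) * p s (a + 1)"
      unfolding p_def
      by (rule e_positive_spider_ineq[OF pos])
        (use assms that in \<open>auto simp: coeff_pCons split: nat.splits\<close>)
    moreover have "a + b + 3 = 3 * (x + y + 1) + 5" "b + 1 = 3 * y + 3" "a + 2 = 3 * x + 5"
      "b + 2 = 3 * y + 4" "a + 1 = 3 * x + 4"
      using a b by simp_all
    ultimately show ?thesis
      by (simp only: F_def p12 mult_zero_left add_0_right)
  qed
  ultimately have "0 \<le> ?V"
    by (rule has_lead_nonneg)
  \<comment> \<open>The quadratic part is grouped around y (y - x), so that \<open>y \<le> x\<close>
    settles its sign; 6 y is absorbed by 57 x, and -32 makes the bracket negative.\<close>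
  also have "?V = 2 ^ (x + y) / 8 *
      (54 * real y * (real y - real x) - 27 * real x * real x - 57 * real x + 6 * real y - 32)"
    by (simp add: power_add field_simps)
  finally have "0 \<le> 54 * real y * (real y - real x) - 27 * real x * real x - 57 * real x +
      6 * real y - 32"
    by (rule mult_left_le_imp_le[of "2 ^ (x + y) / 8" 0, unfolded mult_zero_right]) simp
  moreover have "real y * (real y - real x) \<le> 0"
    using le by (simp add: mult_le_0_iff)
  moreover have "0 \<le> real x * real x"
    by simp
  ultimately show False
    using le by linarith
qed

theorem theorem4p1:
  fixes a b :: nat
  assumes "a \<ge> b" and "b \<ge> 2"
    and "e_positive (a + b + 2 + 1) (spider_adj a b 2)"
  shows "(a mod 3 = 0 \<and> b mod 3 = 1) \<or> b mod 3 = 0"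
proof (rule ccontr)
  assume neg: "\<not> ?thesis"
  define x y where "x = a div 3" and "y = b div 3"
  have ab: "a = 3 * x + a mod 3" "b = 3 * y + b mod 3"
    by (simp_all add: x_def y_def)
  have "a mod 3 = 0 \<or> a mod 3 = 1 \<or> a mod 3 = 2" "b mod 3 = 0 \<or> b mod 3 = 1 \<or> b mod 3 = 2"
    by linarith+
  with neg consider "a mod 3 = 1" "b mod 3 = 1" | "a mod 3 = 2" "b mod 3 = 1"
    | "a mod 3 = 0" "b mod 3 = 2" | "a mod 3 = 1" "b mod 3 = 2" | "a mod 3 = 2" "b mod 3 = 2"
    by metis
  then show False
  proof cases
    case 1
    then have "a = 3 * x + 1" "b = 3 * y + 1" "0 < y"
      using ab assms(2) by linarith+
    then show ?thesis
      using not_e_positive_spider_1_1 assms(3) by blast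
  next
    case 2
    then have "a = 3 * x + 2" "b = 3 * y + 1"
      using ab by linarith+
    then show ?thesis
      using not_e_positive_spider_sum_multiple_of_3 assms(3) by blast
  next
    case 3
    \<comment> \<open>Since a is a multiple of 3 and at least 2, x is positive and the truncated
      subtraction is harmless; 3y + 2 \<le> 3x then gives y < x.\<close>
    then have "a = 3 * (x - 1) + 3" "b = 3 * y + 2" "y \<le> x - 1"
      using ab assms(1,2) by linarith+
    then show ?thesis
      using not_e_positive_spider_0_2 assms(3) by blast
  next
    case 4
    then have "a = 3 * x + 1" "b = 3 * y + 2"
      using ab by linarith+
    then show ?thesis
      using not_e_positive_spider_sum_multiple_of_3 assms(3) by blast
  next
    case 5
    then have "a = 3 * x + 2" "b = 3 * y + 2"
      using ab by linarith+
    then show ?thesis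
      using not_e_positive_spider_2_2 assms(3) by blast
  qed
qed

end
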